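(* Suppose that $R_{q,w}<\infty$ for all $w\ge1$, where $$R_{q,w}=\sum_{s=w}^\infty\binom{s}{w}^2\frac{(1-q)^{2(s-w)}}{q^{2s}}f_{W_q}(s).$$ Then, as $N\to\infty$, $$\bigl\{\sqrt N\,(\widehat f_W(w)-f_W(w))\bigr\}_{w\in\mathbb N}\to\{S(\xi)_w\}_{w\in\mathbb N}$$ in the sense of convergence of finite-dimensional distributions, where $\xi=\{\xi_s\}_{s\in\mathbb N}$ is a zero-mean Gaussian process with covariance structure $$E\xi_{s_1}\xi_{s_2}=f_{W_q}(s_1)\delta_{s_1,s_2}-f_{W_q}(s_1)f_{W_q}(s_2)$$ ($\delta$ is the Kronecker symbol). In particular, the limiting variables $S(\xi)_w$ are zero-mean, Gaussian and have variance $$E\,S(\xi)_w^2=R_{q,w}-f_W(w)^2 .$$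
   Context: $\mathbb N=\{1,2,\dots\}$, $q\in(0,1)$ is fixed. $W$ is a random variable with values in $\mathbb N$ and probability mass function $f_W(w)=P(W=w)$; given $W=w$, $W_q$ is Binomial$(w,q)$ (number of sampled renewals out of $W$), and $f_{W_q}(s)=P(W_q=s)$, $s\ge0$. For a sequence $x=\{x_n\}_{n\in\mathbb N}$, $S(x)=\{S(x)_n\}_{n\in\mathbb N}$ is $$S(x)_n=\sum_{i=n}^\infty\binom{i}{n}\frac{(-1)^{i-n}}{q^i}(1-q)^{i-n}x_i,\qquad n\ge1$$ (for the random sequence $\xi$ the series is understood as an almost surely convergent series). Let $W_{q,1},\dots,W_{q,N}$ be i.i.d. copies of $W_q$, let $\widehat f_{W_q}(s)=\frac1N\sum_{k=1}^N1_{\{W_{q,k}=s\}}$, $s\ge0$, and let the estimator of $f_W$ be $$\widehat f_W(w)=S(\widehat f_{W_q})_w=\sum_{s=w}^\infty\binom{s}{w}\frac{(-1)^{s-w}}{q^s}(1-q)^{s-w}\widehat f_{W_q}(s),\qquad w\ge1$$ (a finite sum for each realization). *)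

theory Defs
  imports "HOL-Probability.Probability"
begin

definition thinned_pmf :: "real \<Rightarrow> nat pmf \<Rightarrow> nat pmf" where
  "thinned_pmf q W = bind_pmf W (\<lambda>w. binomial_pmf w q)"

text \<open>The series over \<open>i \<ge> n\<close> is indexed by \<open>i = n + j\<close>.\<close>

definition S_term :: "real \<Rightarrow> (nat \<Rightarrow> real) \<Rightarrow> nat \<Rightarrow> nat \<Rightarrow> real" where
  "S_term q x n j =
     real ((n + j) choose n) * ((-1) ^ j / q ^ (n + j)) * (1 - q) ^ j * x (n + j)"

text \<open>The order of summation matters, since the convergence need not be absolute
  (for instance along a path of the Gaussian process). The value is meaningful only where
  the series is \<open>summable\<close>.\<close>

definition S_op :: "real \<Rightarrow> (nat \<Rightarrow> real) \<Rightarrow> nat \<Rightarrow> real" where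
  "S_op q x n = (\<Sum>j. S_term q x n j)"

definition R_coeff :: "real \<Rightarrow> nat pmf \<Rightarrow> nat \<Rightarrow> ennreal" where
  "R_coeff q W w =
     (\<Sum>j. ennreal ((real ((w + j) choose w))\<^sup>2 * (1 - q) ^ (2 * j) / q ^ (2 * (w + j))
                   * pmf (thinned_pmf q W) (w + j)))"

text \<open>Samples are numbered from 1.\<close>

definition emp_pmf :: "(nat \<Rightarrow> 'a \<Rightarrow> nat) \<Rightarrow> nat \<Rightarrow> 'a \<Rightarrow> nat \<Rightarrow> real" where
  "emp_pmf X N \<omega> s = (1 / real N) * (\<Sum>k = 1..N. if X k \<omega> = s then 1 else 0)"

definition est_pmf :: "real \<Rightarrow> (nat \<Rightarrow> 'a \<Rightarrow> nat) \<Rightarrow> nat \<Rightarrow> 'a \<Rightarrow> nat \<Rightarrow> real" where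
  "est_pmf q X N \<omega> w = S_op q (emp_pmf X N \<omega>) w"

text \<open>A Gaussian law is allowed to be degenerate, i.e. a point mass, whereas the library's
  \<open>normal_density\<close> describes a normal law only for positive standard deviation.\<close>

definition gaussian_rv :: "'b measure \<Rightarrow> ('b \<Rightarrow> real) \<Rightarrow> bool" where
  "gaussian_rv M Y \<longleftrightarrow> Y \<in> borel_measurable M \<and>
     (\<exists>\<mu> \<sigma>. \<sigma> \<ge> 0 \<and>
        distr M borel Y =
          (if \<sigma> = 0 then return borel \<mu> else density lborel (normal_density \<mu> \<sigma>)))"

definition gaussian_process :: "'b measure \<Rightarrow> 'i set \<Rightarrow> ('i \<Rightarrow> 'b \<Rightarrow> real) \<Rightarrow> bool" where
  "gaussian_process M I Y \<longleftrightarrow>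
     (\<forall>J c. finite J \<and> J \<subseteq> I \<longrightarrow> gaussian_rv M (\<lambda>\<omega>. \<Sum>i\<in>J. c i * Y i \<omega>))"

text \<open>Convergence of finite-dimensional distributions: for every finite \<open>J \<subseteq> I\<close>, weak
  convergence of the laws of \<open>(X N i)\<^sub>i\<^sub>\<in>\<^sub>J\<close> on the product space with index set \<open>J\<close>, tested against
  bounded continuous functions. Points of that space are functions extensional outside \<open>J\<close>.\<close>

definition fdd_convergence ::
  "'i set \<Rightarrow> 'a measure \<Rightarrow> (nat \<Rightarrow> 'i \<Rightarrow> 'a \<Rightarrow> real)
     \<Rightarrow> 'b measure \<Rightarrow> ('i \<Rightarrow> 'b \<Rightarrow> real) \<Rightarrow> bool" where
  "fdd_convergence I M X M' Y \<longleftrightarrow>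
     (\<forall>i\<in>I. (\<forall>N. X N i \<in> borel_measurable M) \<and> Y i \<in> borel_measurable M') \<and>
     (\<forall>J g. finite J \<and> J \<subseteq> I
         \<and> continuous_map (product_topology (\<lambda>_. euclideanreal) J) euclideanreal g
         \<and> bounded (g ` (J \<rightarrow>\<^sub>E UNIV)) \<longrightarrow>
       (\<lambda>N. \<integral>\<omega>. g (\<lambda>i\<in>J. X N i \<omega>) \<partial>M) \<longlonglongrightarrow> (\<integral>\<omega>. g (\<lambda>i\<in>J. Y i \<omega>) \<partial>M'))"

end

theory Submission imports Defs begin

text \<open>Write \<open>p\<close> for the law of \<open>W\<^sub>q\<close> and \<open>S(x)\<^sub>w = \<Sum>\<^sub>s a\<^sub>w(s) x\<^sub>s\<close>. The estimator is the empirical mean of \<open>a\<^sub>w\<close>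
  over the sample, with mean \<open>f\<^sub>W(w)\<close> and second moment \<open>R\<^bsub>q,w\<^esub>\<close> under \<open>p\<close>, so the one-dimensional
  central limit theorem handles each linear combination over \<open>w\<close>, and the Cramer-Wold device gives
  the joint convergence. On the Gaussian side, \<open>\<Sum>\<^sub>s |a\<^sub>w(s)| p(s)\<^bsup>1/2\<^esup> < \<infinity>\<close> because
  \<open>R\<^bsub>q,w+1\<^esub> < \<infinity>\<close>, hence the series \<open>S(\<xi>)\<^sub>w\<close> converges absolutely almost surely, and the
  characteristic functions of its Gaussian partial sums converge.\<close>

section \<open>Normal laws\<close>

text \<open>The limit and the estimator meet in one number. For b = \<Sum> t_w a_w both are governed
  by the variance of b under p: the estimator because it averages b over a sample from p, the
  Gaussian series because the covariance of \<xi> is that of multinomial fluctuations. The process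
  has no index 0, but a_w(0) = 0 for w >= 1, so nothing is lost. The mean f_W(w) is binomial
  inversion: a_w averaged over Binomial(m, q) is 1 if m = w and 0 otherwise. The variables \<xi>_s
  are dependent, and almost sure convergence is obtained without decoupling them: E|\<xi>_s| <=
  sqrt(p(s)) reduces it to an absolute bound. Compared with square summability this costs a factor s
  - w, and (s - w) a_w(s) equals (w + 1) (1 - q) a_{w+1}(s) up to sign; this is why the next
  coefficient enters. Limit variances may vanish, so standard deviation 0 is carried along
  throughout and gets its own case in the central limit theorem.\<close>

definition normal_law :: "real \<Rightarrow> real \<Rightarrow> real measure" where
  "normal_law \<mu> \<sigma> = distr std_normal_distribution borel (\<lambda>x. \<mu> + \<sigma> * x)"

lemma density_normal_eq_normal_law:
  assumes "\<sigma> > 0"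
  shows "density lborel (normal_density \<mu> \<sigma>) = normal_law \<mu> \<sigma>"
proof -
  interpret prob_space std_normal_distribution
    by (rule prob_space_normal_density) simp
  have "distributed std_normal_distribution lborel (\<lambda>x. x) std_normal_density"
    by (auto simp: distributed_def intro!: measure_eqI)
       (metis (no_types) distr_id2 sets_density sets_lborel)
  from normal_density_affine[OF this, of \<sigma> \<mu>] assms
  have "distr std_normal_distribution lborel (\<lambda>x. \<mu> + \<sigma> * x) = density lborel (normal_density \<mu> \<sigma>)"
    by (simp add: distributed_def)
  moreover have "distr std_normal_distribution lborel (\<lambda>x. \<mu> + \<sigma> * x) = normal_law \<mu> \<sigma>"
    unfolding normal_law_def by (rule distr_cong) auto
  ultimately show ?thesis by simp
qed

lemma return_eq_normal_law: "return borel \<mu> = normal_law \<mu> 0"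
proof -
  interpret prob_space std_normal_distribution
    by (rule prob_space_normal_density) simp
  show ?thesis unfolding normal_law_def by (simp add: distr_const)
qed

text \<open>An affine image of the standard normal law becomes a point mass at \<sigma> = 0, so the
  two cases of \<open>gaussian_rv\<close> merge and one formula for the characteristic function
  covers both.\<close>

lemma gaussian_rv_iff_normal_law:
  "gaussian_rv M Y \<longleftrightarrow>
     Y \<in> borel_measurable M \<and> (\<exists>\<mu> \<sigma>. \<sigma> \<ge> 0 \<and> distr M borel Y = normal_law \<mu> \<sigma>)"
proof -
  have "(if \<sigma> = 0 then return borel \<mu> else density lborel (normal_density \<mu> \<sigma>)) = normal_law \<mu> \<sigma>"
    if "\<sigma> \<ge> 0" for \<mu> \<sigma>
    using that density_normal_eq_normal_law[of \<sigma> \<mu>] return_eq_normal_law[of \<mu>] by simp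
  then show ?thesis unfolding gaussian_rv_def by (metis (no_types, lifting))
qed

lemma real_distribution_normal_law: "real_distribution (normal_law \<mu> \<sigma>)"
proof -
  interpret prob_space std_normal_distribution
    by (rule prob_space_normal_density) simp
  show ?thesis unfolding normal_law_def by (rule real_distribution_distr) simp
qed

text \<open>Serves to recover \<mu> and \<sigma> from prescribed moments, and to supply
  integrability. The latter cannot be read off from a prescribed value of an integral, since a
  non-integrable function has integral 0 by convention.\<close>

lemma normal_law_moments:
  assumes Y[measurable]: "Y \<in> borel_measurable M" and D: "distr M borel Y = normal_law \<mu> \<sigma>"
  shows "integrable M Y" "integrable M (\<lambda>x. (Y x)\<^sup>2)"
    and "(\<integral>x. Y x \<partial>M) = \<mu>" "(\<integral>x. (Y x)\<^sup>2 \<partial>M) = \<mu>\<^sup>2 + \<sigma>\<^sup>2"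
proof -
  interpret prob_space std_normal_distribution
    by (rule prob_space_normal_density) simp
  note i = integrable_std_normal_distribution_moment
  have i1: "integrable std_normal_distribution (\<lambda>x. x)"
    using i[of 1] by simp
  have e1: "integral\<^sup>L std_normal_distribution (\<lambda>x. x) = 0"
    using integral_std_normal_distribution_moment_odd[of 1] by simp
  have e2: "integral\<^sup>L std_normal_distribution (\<lambda>x. x^2) = 1"
    using std_normal_distribution_even_moments(1)[of 1] by (simp add: fact_numeral)
  have sq: "(\<lambda>x. (\<mu> + \<sigma> * x)\<^sup>2) = (\<lambda>x. \<mu>\<^sup>2 + 2 * \<mu> * \<sigma> * x + \<sigma>\<^sup>2 * x\<^sup>2)"
    by (auto simp: power2_eq_square algebra_simps)
  have "integrable (normal_law \<mu> \<sigma>) (\<lambda>x. x)" unfolding normal_law_def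
    by (subst integrable_distr_eq) (auto intro!: i1)
  then show "integrable M Y" unfolding D[symmetric] by (subst (asm) integrable_distr_eq) auto
  have i2: "integrable std_normal_distribution (\<lambda>x. (\<mu> + \<sigma> * x)\<^sup>2)"
    unfolding sq by (intro Bochner_Integration.integrable_add integrable_mult_right i1 i integrable_const)
  have "integrable (normal_law \<mu> \<sigma>) (\<lambda>x. x\<^sup>2)" unfolding normal_law_def
    by (subst integrable_distr_eq) (use i2 in auto)
  then show "integrable M (\<lambda>x. (Y x)\<^sup>2)"
    unfolding D[symmetric] by (subst (asm) integrable_distr_eq) auto
  have "integral\<^sup>L std_normal_distribution (\<lambda>x. \<mu> + \<sigma> * x) = \<mu>"
    by (subst Bochner_Integration.integral_add; (intro integrable_mult_right i1 integrable_const)?)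
       (use prob_space in \<open>simp add: e1\<close>)
  then have "integral\<^sup>L (normal_law \<mu> \<sigma>) (\<lambda>x. x) = \<mu>" unfolding normal_law_def
    by (subst integral_distr) auto
  then show "(\<integral>x. Y x \<partial>M) = \<mu>" unfolding D[symmetric] by (subst (asm) integral_distr) auto
  have "integral\<^sup>L std_normal_distribution (\<lambda>x. (\<mu> + \<sigma> * x)\<^sup>2) = \<mu>\<^sup>2 + \<sigma>\<^sup>2"
    unfolding sq
    by (subst Bochner_Integration.integral_add;
        (intro Bochner_Integration.integrable_add integrable_mult_right i1 i integrable_const)?)+
       (use prob_space in \<open>simp add: e1 e2\<close>)
  then have "integral\<^sup>L (normal_law \<mu> \<sigma>) (\<lambda>x. x\<^sup>2) = \<mu>\<^sup>2 + \<sigma>\<^sup>2" unfolding normal_law_def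
    by (subst integral_distr) auto
  then show "(\<integral>x. (Y x)\<^sup>2 \<partial>M) = \<mu>\<^sup>2 + \<sigma>\<^sup>2"
    unfolding D[symmetric] by (subst (asm) integral_distr) auto
qed

lemma char_distr:
  assumes [measurable]: "Y \<in> borel_measurable M"
  shows "char (distr M borel Y) t = (\<integral>x. iexp (t * Y x) \<partial>M)"
  unfolding char_def by (subst integral_distr) auto

lemma char_normal_law: "char (normal_law 0 \<sigma>) t = exp (- ((\<sigma> * t)\<^sup>2) / 2)"
proof -
  have "char (normal_law 0 \<sigma>) t = char std_normal_distribution (\<sigma> * t)"
    unfolding normal_law_def by (subst char_distr) (auto simp: char_def mult_ac)
  then show ?thesis by (simp add: char_std_normal_distribution)
qed

section \<open>Moment bounds and almost sure absolute summability\<close>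

lemma (in prob_space) expectation_abs_le:
  fixes Y :: "'a \<Rightarrow> real"
  assumes "Y \<in> borel_measurable M" and "integrable M (\<lambda>x. (Y x)\<^sup>2)"
  shows "expectation (\<lambda>x. \<bar>Y x\<bar>) \<le> sqrt (expectation (\<lambda>x. (Y x)\<^sup>2))"
proof -
  have "integrable M (\<lambda>x. \<bar>Y x\<bar>)"
    using square_integrable_imp_integrable[OF assms] by simp
  then have "0 \<le> expectation (\<lambda>x. \<bar>Y x\<bar>\<^sup>2) - (expectation (\<lambda>x. \<bar>Y x\<bar>))\<^sup>2"
    using variance_eq[of "\<lambda>x. \<bar>Y x\<bar>"] variance_positive[of "\<lambda>x. \<bar>Y x\<bar>"] assms by simp
  then show ?thesis by (intro real_le_rsqrt) simp
qed

text \<open>By Tonelli the sum of the |f i| has a finite integral and is therefore finite almost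
  everywhere. The bound looks at each f i separately, so it suits dependent variables.\<close>

lemma AE_summable_if_summable_integral_norm:
  fixes f :: "nat \<Rightarrow> 'a \<Rightarrow> real"
  assumes int: "\<And>i. integrable M (f i)" and sum: "summable (\<lambda>i. \<integral>x. \<bar>f i x\<bar> \<partial>M)"
  shows "AE x in M. summable (\<lambda>i. \<bar>f i x\<bar>)"
proof -
  have [measurable]: "f i \<in> borel_measurable M" for i using int by auto
  have "(\<integral>\<^sup>+x. (\<Sum>i. ennreal \<bar>f i x\<bar>) \<partial>M) = (\<Sum>i. \<integral>\<^sup>+x. ennreal \<bar>f i x\<bar> \<partial>M)"
    by (rule nn_integral_suminf) simp
  also have "\<dots> = (\<Sum>i. ennreal (\<integral>x. \<bar>f i x\<bar> \<partial>M))"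
    by (intro suminf_cong nn_integral_eq_integral) (use int in auto)
  also have "\<dots> \<noteq> \<infinity>"
    by (subst suminf_ennreal2[OF _ sum]) auto
  finally have "AE x in M. (\<Sum>i. ennreal \<bar>f i x\<bar>) \<noteq> \<infinity>"
    by (intro nn_integral_noteq_infinite) auto
  then show ?thesis by eventually_elim (auto intro: summable_suminf_not_top)
qed


section \<open>Series of a Gaussian process with multinomial covariance\<close>

lemma integrable_mult_square:
  fixes f g :: "'a \<Rightarrow> real"
  assumes [measurable]: "f \<in> borel_measurable M" "g \<in> borel_measurable M"
    and f: "integrable M (\<lambda>x. (f x)\<^sup>2)" and g: "integrable M (\<lambda>x. (g x)\<^sup>2)"
  shows "integrable M (\<lambda>x. f x * g x)"
proof (rule Bochner_Integration.integrable_bound)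
  show "integrable M (\<lambda>x. (f x)\<^sup>2 + (g x)\<^sup>2)" using f g by simp
  have "\<bar>f x * g x\<bar> \<le> (f x)\<^sup>2 + (g x)\<^sup>2" for x
  proof -
    have "0 \<le> (\<bar>f x\<bar> - \<bar>g x\<bar>)\<^sup>2" by simp
    also have "\<dots> = (f x)\<^sup>2 + (g x)\<^sup>2 - 2 * \<bar>f x * g x\<bar>"
      by (simp add: power2_diff abs_mult)
    finally show ?thesis by (smt (verit) zero_le_power2)
  qed
  then show "AE x in M. norm (f x * g x) \<le> norm ((f x)\<^sup>2 + (g x)\<^sup>2)" by simp
qed simp

lemma summable_power2_if_summable_abs:
  fixes f :: "nat \<Rightarrow> real"
  assumes "summable (\<lambda>s. \<bar>f s\<bar>)"
  shows "summable (\<lambda>s. (f s)\<^sup>2)"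
proof (rule summable_comparison_test_ev[OF _ assms])
  have "(\<lambda>s. \<bar>f s\<bar>) \<longlonglongrightarrow> 0" by (rule summable_LIMSEQ_zero[OF assms])
  then have "\<forall>\<^sub>F s in sequentially. \<bar>f s\<bar> < 1" by (rule order_tendstoD) simp
  then show "\<forall>\<^sub>F s in sequentially. norm ((f s)\<^sup>2) \<le> \<bar>f s\<bar>"
  proof eventually_elim
    case (elim s)
    then have "\<bar>f s\<bar> * \<bar>f s\<bar> \<le> 1 * \<bar>f s\<bar>" by (intro mult_right_mono) auto
    then show ?case by (simp add: power2_eq_square)
  qed
qed

text \<open>Summability of |b| sqrt(p) is the one condition imposed on coefficient sequences. Its
  terms are eventually below 1 and so dominate their squares, which are the terms of the second
  moment of b; the first moment follows in the next lemma from p <= sqrt(p).\<close>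

lemma summable_square_pmf_if_summable_sqrt:
  fixes b :: "nat \<Rightarrow> real"
  assumes "summable (\<lambda>s. \<bar>b s\<bar> * sqrt (pmf p s))"
  shows "summable (\<lambda>s. \<bar>(b s)\<^sup>2\<bar> * pmf p s)"
proof -
  have "summable (\<lambda>s. \<bar>b s * sqrt (pmf p s)\<bar>)" using assms by (simp add: abs_mult)
  from summable_power2_if_summable_abs[OF this] show ?thesis by (simp add: power_mult_distrib)
qed

lemma summable_abs_pmf_if_summable_sqrt:
  fixes b :: "nat \<Rightarrow> real"
  assumes "summable (\<lambda>s. \<bar>b s\<bar> * sqrt (pmf p s))"
  shows "summable (\<lambda>s. \<bar>b s\<bar> * pmf p s)"
proof (rule summable_comparison_test'[OF assms])
  fix s
  have "pmf p s * pmf p s \<le> pmf p s * 1" by (intro mult_left_mono) (auto simp: pmf_le_1)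
  then have "pmf p s \<le> sqrt (pmf p s)"
    by (intro real_le_rsqrt) (simp add: power2_eq_square)
  then show "norm (\<bar>b s\<bar> * pmf p s) \<le> \<bar>b s\<bar> * sqrt (pmf p s)"
    by (simp add: mult_left_mono)
qed

text \<open>The covariance is that of the limiting fluctuations of empirical frequencies under p,
  restricted to the indices s >= 1. Nothing is known about \<open>\<xi> 0\<close>, not even
  measurability, which is the origin of the side condition \<open>b 0 = 0\<close> below.\<close>

locale multinomial_gaussian =
  prob_space M' for M' :: "'b measure" +
  fixes p :: "nat pmf" and \<xi> :: "nat \<Rightarrow> 'b \<Rightarrow> real"
  assumes gauss: "gaussian_process M' {1..} \<xi>"
    and mean: "\<And>s. s \<ge> 1 \<Longrightarrow> (\<integral>\<omega>. \<xi> s \<omega> \<partial>M') = 0"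
    and cov: "\<And>s t. s \<ge> 1 \<Longrightarrow> t \<ge> 1 \<Longrightarrow>
          (\<integral>\<omega>. \<xi> s \<omega> * \<xi> t \<omega> \<partial>M') = pmf p s * (if s = t then 1 else 0) - pmf p s * pmf p t"
begin

lemma gaussian_rv_xi: "s \<ge> 1 \<Longrightarrow> gaussian_rv M' (\<xi> s)"
  using gauss[unfolded gaussian_process_def, rule_format, of "{s}" "\<lambda>_. 1"] by simp

lemma measurable_xi: "s \<ge> 1 \<Longrightarrow> \<xi> s \<in> borel_measurable M'"
  using gaussian_rv_xi unfolding gaussian_rv_def by blast

lemma square_integrable_xi: "s \<ge> 1 \<Longrightarrow> integrable M' (\<lambda>\<omega>. (\<xi> s \<omega>)\<^sup>2)"
  using gaussian_rv_xi normal_law_moments(2) unfolding gaussian_rv_iff_normal_law by blast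

lemma integrable_xi: "s \<ge> 1 \<Longrightarrow> integrable M' (\<xi> s)"
  by (rule square_integrable_imp_integrable[OF measurable_xi square_integrable_xi])

lemma integrable_xi_mult: "s \<ge> 1 \<Longrightarrow> t \<ge> 1 \<Longrightarrow> integrable M' (\<lambda>\<omega>. \<xi> s \<omega> * \<xi> t \<omega>)"
  by (intro integrable_mult_square measurable_xi square_integrable_xi)

lemma expectation_abs_xi_le:
  assumes "s \<ge> 1" shows "expectation (\<lambda>\<omega>. \<bar>\<xi> s \<omega>\<bar>) \<le> sqrt (pmf p s)"
proof -
  \<comment> \<open>The variance is p(s) - p(s)^2.\<close>
  have "expectation (\<lambda>\<omega>. (\<xi> s \<omega>)\<^sup>2) \<le> pmf p s"
    using cov[OF assms assms] by (simp add: power2_eq_square)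
  then show ?thesis
    using expectation_abs_le[OF measurable_xi square_integrable_xi, OF assms assms]
    by (meson order_trans real_sqrt_le_mono)
qed

lemma AE_summable_series:
  assumes b: "b 0 = 0" "summable (\<lambda>s. \<bar>b s\<bar> * sqrt (pmf p s))"
  shows "AE \<omega> in M'. summable (\<lambda>s. \<bar>b s * \<xi> s \<omega>\<bar>)"
proof (rule AE_summable_if_summable_integral_norm)
  show int: "integrable M' (\<lambda>\<omega>. b s * \<xi> s \<omega>)" for s
    using b(1) integrable_xi[of s] by (cases "s = 0") auto
  show "summable (\<lambda>s. \<integral>\<omega>. \<bar>b s * \<xi> s \<omega>\<bar> \<partial>M')"
  proof (rule summable_comparison_test'[OF b(2)])
    fix s :: nat
    show "norm (\<integral>\<omega>. \<bar>b s * \<xi> s \<omega>\<bar> \<partial>M') \<le> \<bar>b s\<bar> * sqrt (pmf p s)"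
      using b(1) expectation_abs_xi_le[of s]
      by (cases "s = 0") (auto simp: abs_mult intro: mult_left_mono)
  qed
qed

text \<open>Gaussianity of the finite combination is the definition of a Gaussian process; the two
  parameters are then forced by the first two moments. \<open>V n\<close> is the variance under p of
  b cut off at n.\<close>

lemma partial_sum_law:
  fixes b :: "nat \<Rightarrow> real"
  assumes b: "b 0 = 0"
  defines "V \<equiv> \<lambda>n. (\<Sum>s<n. (b s)\<^sup>2 * pmf p s) - (\<Sum>s<n. b s * pmf p s)\<^sup>2"
  shows "V n \<ge> 0" and "distr M' borel (\<lambda>\<omega>. \<Sum>s<n. b s * \<xi> s \<omega>) = normal_law 0 (sqrt (V n))"
    and "(\<lambda>\<omega>. \<Sum>s<n. b s * \<xi> s \<omega>) \<in> borel_measurable M'"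
proof -
  define L where "L \<omega> = (\<Sum>s<n. b s * \<xi> s \<omega>)" for \<omega>
  \<comment> \<open>The term s = 0 has to go before \<open>gauss\<close> applies, since 0 lies
    outside the index set.\<close>
  have L_eq: "L \<omega> = (\<Sum>s\<in>{1..<n}. b s * \<xi> s \<omega>)" for \<omega>
    unfolding L_def by (rule sum.mono_neutral_right) (use b in \<open>auto simp: not_le\<close>)
  have red: "(\<Sum>s\<in>{1..<n}. b s * f s) = (\<Sum>s<n. b s * f s)" for f :: "nat \<Rightarrow> real"
    by (rule sum.mono_neutral_left) (use b in \<open>auto simp: not_le\<close>)
  have "gaussian_rv M' L"
    using gauss[unfolded gaussian_process_def, rule_format, of "{1..<n}" b]
    by (simp add: L_eq[abs_def] subset_eq)
  then obtain \<mu> \<sigma> where L: "L \<in> borel_measurable M'" "\<sigma> \<ge> 0" "distr M' borel L = normal_law \<mu> \<sigma>"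
    unfolding gaussian_rv_iff_normal_law by blast
  have "\<mu> = expectation L" using normal_law_moments(3)[OF L(1,3)] by simp
  also have "\<dots> = 0" unfolding L_eq[abs_def]
    by (subst Bochner_Integration.integral_sum) (auto simp: integrable_xi mean)
  finally have mu: "\<mu> = 0" .
  have sq: "(L \<omega>)\<^sup>2 = (\<Sum>s\<in>{1..<n}. \<Sum>t\<in>{1..<n}. b s * b t * (\<xi> s \<omega> * \<xi> t \<omega>))" for \<omega>
    unfolding L_eq power2_eq_square sum_product by (simp add: mult_ac)
  have "\<sigma>\<^sup>2 = expectation (\<lambda>\<omega>. (L \<omega>)\<^sup>2)" using normal_law_moments(4)[OF L(1,3)] mu by simp
  also have "\<dots> = (\<Sum>s\<in>{1..<n}. \<Sum>t\<in>{1..<n}. b s * b t * expectation (\<lambda>\<omega>. \<xi> s \<omega> * \<xi> t \<omega>))"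
    unfolding sq
    by (subst Bochner_Integration.integral_sum, force intro: integrable_xi_mult, rule sum.cong[OF refl],
        subst Bochner_Integration.integral_sum) (auto intro: integrable_xi_mult)
  also have "\<dots> = (\<Sum>s\<in>{1..<n}. \<Sum>t\<in>{1..<n}. b s * b t * (pmf p s * (if s = t then 1 else 0) - pmf p s * pmf p t))"
    by (intro sum.cong refl) (simp add: cov)
  also have "\<dots> = (\<Sum>s\<in>{1..<n}. b s * (b s * pmf p s)) - (\<Sum>s\<in>{1..<n}. b s * pmf p s)\<^sup>2"
    by (simp add: right_diff_distrib sum_subtractf power2_eq_square sum_product mult_ac
                  if_distrib[of "\<lambda>x. _ * x"] sum.delta' cong: if_cong)
  also have "\<dots> = V n" unfolding red V_def by (simp add: power2_eq_square mult_ac)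
  finally have V: "\<sigma>\<^sup>2 = V n" .
  show "V n \<ge> 0" using V by (metis zero_le_power2)
  have "sqrt (V n) = \<sigma>" using L(2) unfolding V[symmetric] by simp
  then show "distr M' borel (\<lambda>\<omega>. \<Sum>s<n. b s * \<xi> s \<omega>) = normal_law 0 (sqrt (V n))"
    using L(3) mu by (simp add: L_def[abs_def])
  show "(\<lambda>\<omega>. \<Sum>s<n. b s * \<xi> s \<omega>) \<in> borel_measurable M'"
    using L(1) by (simp add: L_def[abs_def])
qed

text \<open>Almost sure convergence of the partial sums carries over to their characteristic
  functions by dominated convergence, while the explicit Gaussian form shows that these tend to the
  one with variance \<open>V\<close>. Uniqueness of characteristic functions identifies the law,
  also for \<open>V = 0\<close>.\<close>

lemma series_law:
  fixes b :: "nat \<Rightarrow> real"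
  assumes b: "b 0 = 0" "summable (\<lambda>s. \<bar>b s\<bar> * sqrt (pmf p s))"
    and Y[measurable]: "Y \<in> borel_measurable M'"
    and sums: "AE \<omega> in M'. (\<lambda>s. b s * \<xi> s \<omega>) sums Y \<omega>"
  defines "V \<equiv> (\<Sum>s. (b s)\<^sup>2 * pmf p s) - (\<Sum>s. b s * pmf p s)\<^sup>2"
  shows "V \<ge> 0" and "distr M' borel Y = normal_law 0 (sqrt V)"
proof -
  define L where "L n \<omega> = (\<Sum>s<n. b s * \<xi> s \<omega>)" for n \<omega>
  define Vn where "Vn n = (\<Sum>s<n. (b s)\<^sup>2 * pmf p s) - (\<Sum>s<n. b s * pmf p s)\<^sup>2" for n
  note L = partial_sum_law[of b, OF b(1), folded L_def Vn_def]
  have [measurable]: "L n \<in> borel_measurable M'" for n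
    using L(3) by (simp add: L_def[abs_def])
  have s2: "summable (\<lambda>s. (b s)\<^sup>2 * pmf p s)"
    using summable_square_pmf_if_summable_sqrt[OF b(2)] by simp
  have s1: "summable (\<lambda>s. b s * pmf p s)"
    using summable_abs_pmf_if_summable_sqrt[OF b(2)]
    by (intro summable_rabs_cancel[of "\<lambda>s. b s * pmf p s"]) (simp add: abs_mult)
  have V: "Vn \<longlonglongrightarrow> V" unfolding Vn_def V_def
    by (intro tendsto_intros summable_LIMSEQ s1 s2)
  show V0: "V \<ge> 0" by (rule LIMSEQ_le_const[OF V]) (use L(1) in auto)
  have "char (distr M' borel Y) t = char (normal_law 0 (sqrt V)) t" for t
  proof (rule LIMSEQ_unique)
    have c: "char (distr M' borel (L n)) t = exp (- (Vn n * t\<^sup>2) / 2)" for n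
      using L(1)[of n] L(2)[of n] by (simp add: char_normal_law power_mult_distrib L_def[abs_def])
    show "(\<lambda>n. char (distr M' borel (L n)) t) \<longlonglongrightarrow> char (normal_law 0 (sqrt V)) t"
      unfolding c using V0 by (simp add: char_normal_law power_mult_distrib) (intro tendsto_intros V; simp)
    have "(\<lambda>n. \<integral>\<omega>. iexp (t * L n \<omega>) \<partial>M') \<longlonglongrightarrow> (\<integral>\<omega>. iexp (t * Y \<omega>) \<partial>M')"
    proof (rule integral_dominated_convergence[where w = "\<lambda>_. 1"])
      show "AE \<omega> in M'. (\<lambda>n. iexp (t * L n \<omega>)) \<longlonglongrightarrow> iexp (t * Y \<omega>)"
        using sums
      proof eventually_elim
        case (elim \<omega>)
        then have "(\<lambda>n. L n \<omega>) \<longlonglongrightarrow> Y \<omega>" by (simp add: sums_def L_def)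
        then show ?case by (intro tendsto_intros)
      qed
    qed auto
    then show "(\<lambda>n. char (distr M' borel (L n)) t) \<longlonglongrightarrow> char (distr M' borel Y) t"
      by (simp add: char_distr)
  qed
  then show "distr M' borel Y = normal_law 0 (sqrt V)"
    by (intro Levy_uniqueness real_distribution_distr real_distribution_normal_law ext) auto
qed

end


section \<open>The Cramer-Wold device\<close>

text \<open>The real linear span of cosines of affine forms. The phase b provides sines as well. The
  expectation of a generator depends only on the law of one linear combination of the coordinates,
  which is exactly what the Cramer-Wold hypothesis controls.\<close>

inductive_set trig_poly :: "'i set \<Rightarrow> (('i \<Rightarrow> real) \<Rightarrow> real) set" for J where
  cos: "(\<lambda>x. r * cos ((\<Sum>j\<in>J. t j * x j) + b)) \<in> trig_poly J"
| add: "f \<in> trig_poly J \<Longrightarrow> g \<in> trig_poly J \<Longrightarrow> (\<lambda>x. f x + g x) \<in> trig_poly J"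

text \<open>The product-to-sum formula for cosines turns a product of generators into a sum of two
  generators, with frequencies and phases subtracted and added.\<close>

lemma trig_poly_mult:
  assumes "f \<in> trig_poly J" "g \<in> trig_poly J"
  shows "(\<lambda>x. f x * g x) \<in> trig_poly J"
  using assms(1)
proof induction
  case (cos r t b)
  show ?case using assms(2)
  proof induction
    case (cos r' t' b')
    have "(\<lambda>x. (r * cos ((\<Sum>j\<in>J. t j * x j) + b)) * (r' * cos ((\<Sum>j\<in>J. t' j * x j) + b'))) =
      (\<lambda>x. (r * r' / 2) * cos ((\<Sum>j\<in>J. (t j - t' j) * x j) + (b - b'))
         + (r * r' / 2) * cos ((\<Sum>j\<in>J. (t j + t' j) * x j) + (b + b')))"
    proof
      fix x :: "'a \<Rightarrow> real"
      have "(\<Sum>j\<in>J. (t j - t' j) * x j) + (b - b')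
              = ((\<Sum>j\<in>J. t j * x j) + b) - ((\<Sum>j\<in>J. t' j * x j) + b')"
           "(\<Sum>j\<in>J. (t j + t' j) * x j) + (b + b')
              = ((\<Sum>j\<in>J. t j * x j) + b) + ((\<Sum>j\<in>J. t' j * x j) + b')"
        by (simp_all add: left_diff_distrib distrib_right sum_subtractf sum.distrib)
      then show "(r * cos ((\<Sum>j\<in>J. t j * x j) + b)) * (r' * cos ((\<Sum>j\<in>J. t' j * x j) + b')) =
         (r * r' / 2) * cos ((\<Sum>j\<in>J. (t j - t' j) * x j) + (b - b'))
         + (r * r' / 2) * cos ((\<Sum>j\<in>J. (t j + t' j) * x j) + (b + b'))"
        by (simp only: cos_diff cos_add) (simp add: field_simps)
    qed
    also have "\<dots> \<in> trig_poly J" by (intro trig_poly.intros)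
    finally show ?case .
  qed (simp add: distrib_left trig_poly.add)
qed (simp add: distrib_right trig_poly.add)

lemma trig_poly_const: "(\<lambda>_. c) \<in> trig_poly J"
  using trig_poly.cos[of c "\<lambda>_. 0" J 0] by simp

lemma trig_poly_sin:
  assumes "finite J" "j \<in> J"
  shows "(\<lambda>x. sin (c * x j)) \<in> trig_poly J"
proof -
  have "(\<lambda>x. sin (c * x j)) = (\<lambda>x. 1 * cos ((\<Sum>i\<in>J. (if i = j then c else 0) * x i) + (- pi / 2)))"
    using assms by (simp add: if_distrib[of "\<lambda>y. y * _"] cong: if_cong)
       (simp add: cos_diff)
  also have "\<dots> \<in> trig_poly J" by (rule trig_poly.cos)
  finally show ?thesis .
qed

text \<open>The algebra fed to Stone-Weierstrass. Being generated inductively, it is carried into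
  \<open>trig_poly\<close> by an induction once sines are substituted for the coordinates.\<close>

inductive_set coord_poly :: "'i set \<Rightarrow> (('i \<Rightarrow> real) \<Rightarrow> real) set" for J where
  const: "(\<lambda>_. c) \<in> coord_poly J"
| coord: "j \<in> J \<Longrightarrow> (\<lambda>u. u j) \<in> coord_poly J"
| add: "f \<in> coord_poly J \<Longrightarrow> g \<in> coord_poly J \<Longrightarrow> (\<lambda>x. f x + g x) \<in> coord_poly J"
| mult: "f \<in> coord_poly J \<Longrightarrow> g \<in> coord_poly J \<Longrightarrow> (\<lambda>x. f x * g x) \<in> coord_poly J"

lemma continuous_on_coord_poly: "f \<in> coord_poly J \<Longrightarrow> continuous_on S f"
proof (induction rule: coord_poly.induct)
  case (coord j)
  show ?case by (rule continuous_on_subset[OF continuous_on_product_coordinates subset_UNIV])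
qed (auto intro!: continuous_intros)

lemma coord_poly_sin:
  assumes "finite J" "f \<in> coord_poly J"
  shows "(\<lambda>x. f (\<lambda>j. sin (c * x j))) \<in> trig_poly J"
  using assms(2)
  by induction
     (auto intro: trig_poly_const trig_poly_sin[OF assms(1)] trig_poly.add trig_poly_mult)

text \<open>Compactness is Tychonoff's theorem. Pinning the coordinates outside \<open>J\<close> to
  0 keeps the cube inside the full function type, and any two of its points then differ in a
  coordinate from \<open>J\<close>.\<close>

lemma compact_cube:
  fixes J :: "'i set"
  shows "compact {u. \<forall>i. u i \<in> (if i \<in> J then {-1..1} else {0::real})}"
proof -
  have "compactin (product_topology (\<lambda>i. euclidean) UNIV)
          (Pi\<^sub>E UNIV (\<lambda>i. if i \<in> J then {-1..1} else {0::real}))"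
    by (subst compactin_PiE) (auto simp: compact_imp_compactin_subtopology)
  then show ?thesis
    by (simp add: euclidean_product_topology PiE_UNIV_domain Pi_def)
qed

text \<open>Composing with \<open>x \<mapsto> arcsin (sin (c x)) / c\<close> in every coordinate changes nothing
  on a large cube and turns a continuous function into a continuous function of finitely many sines,
  so that polynomial approximation on \<open>[-1, 1]\<^sup>J\<close> gives an approximation by trigonometric
  polynomials that is uniform on the whole space.\<close>

lemma trig_poly_approx:
  fixes G :: "('i::countable \<Rightarrow> real) \<Rightarrow> real"
  assumes J: "finite J" and G: "continuous_on UNIV G" and c: "c > 0" and e: "e > 0"
  obtains P where "P \<in> trig_poly J"
    and "\<And>x. \<bar>G (\<lambda>j. if j \<in> J then arcsin (sin (c * x j)) / c else 0) - P x\<bar> < e"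
proof -
  define S where "S = {u. \<forall>i. u i \<in> (if i \<in> J then {-1..1} else {0::real})}"
  interpret function_ring_on "coord_poly J" S
  proof
    show "compact S" unfolding S_def by (rule compact_cube)
    fix x y assume "x \<in> S" "y \<in> S" "x \<noteq> y"
    then obtain j where "x j \<noteq> y j" by auto
    with \<open>x \<in> S\<close> \<open>y \<in> S\<close> have "j \<in> J" by (auto simp: S_def split: if_splits) (metis)
    with \<open>x j \<noteq> y j\<close> show "\<exists>f\<in>coord_poly J. f x \<noteq> f y"
      by (intro bexI[of _ "\<lambda>u. u j"]) (auto intro: coord_poly.coord)
  qed (fact continuous_on_coord_poly coord_poly.add coord_poly.mult coord_poly.const)+
  define F where "F u = G (\<lambda>j. if j \<in> J then arcsin (u j) / c else 0)" for u
  have "continuous_on S (\<lambda>u j. if j \<in> J then arcsin (u j) / c else 0)"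
  proof (rule continuous_on_coordinatewise_then_product)
    fix j
    show "continuous_on S (\<lambda>u. if j \<in> J then arcsin (u j) / c else 0)"
    proof (cases "j \<in> J")
      case True
      have "continuous_on S (\<lambda>u. u j)"
        by (rule continuous_on_subset[OF continuous_on_product_coordinates subset_UNIV])
      then have "continuous_on S (\<lambda>u. arcsin (u j))"
        by (rule continuous_on_arcsin) (use True in \<open>auto simp: S_def dest: spec[of _ j]\<close>)
      then show ?thesis using True c by (auto intro!: continuous_intros)
    qed simp
  qed
  then have "continuous_on S F" unfolding F_def
    by (rule continuous_on_compose2[OF G]) auto
  from Stone_Weierstrass_basic[OF this e]
  obtain g where g: "g \<in> coord_poly J" "\<And>u. u \<in> S \<Longrightarrow> \<bar>F u - g u\<bar> < e" by auto
  define g' where "g' x = g (\<lambda>j. sin (c * x j))" for x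
  \<comment> \<open>The vector of all sines need not lie in \<open>S\<close>, because its
    coordinates outside \<open>J\<close> are not zero. A coordinate polynomial does not see them, so
    they may be replaced by 0.\<close>
  have indep: "f u = f (\<lambda>j. if j \<in> J then u j else 0)" if "f \<in> coord_poly J" for f and u :: "'i \<Rightarrow> real"
    using that by induction auto
  show thesis
  proof
    show "g' \<in> trig_poly J" unfolding g'_def by (rule coord_poly_sin[OF J g(1)])
    fix x :: "'i \<Rightarrow> real"
    define u where "u j = (if j \<in> J then sin (c * x j) else 0)" for j
    have "u \<in> S" by (auto simp: S_def u_def)
    moreover have "g' x = g u"
      unfolding g'_def u_def by (rule indep[OF g(1)])
    moreover have "F u = G (\<lambda>j. if j \<in> J then arcsin (sin (c * x j)) / c else 0)"
      unfolding F_def u_def by (rule arg_cong[where f = G]) auto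
    ultimately show "\<bar>G (\<lambda>j. if j \<in> J then arcsin (sin (c * x j)) / c else 0) - g' x\<bar> < e"
      using g(2) by metis
  qed
qed


section \<open>Tail control and the passage from linear combinations to joint convergence\<close>

lemma measurable_padded:
  fixes X :: "'i::countable \<Rightarrow> 'a \<Rightarrow> real" and G :: "('i \<Rightarrow> real) \<Rightarrow> real"
  assumes X: "\<And>j. j \<in> J \<Longrightarrow> X j \<in> borel_measurable M" and G: "continuous_on UNIV G"
  shows "(\<lambda>\<omega>. G (\<lambda>j. if j \<in> J then X j \<omega> else 0)) \<in> borel_measurable M"
proof (rule measurable_compose[OF _ borel_measurable_continuous_onI[OF G]])
  show "(\<lambda>\<omega> j. if j \<in> J then X j \<omega> else 0) \<in> borel_measurable M"
  \<comment> \<open>Countability of the index type enters here: the Borel sets of the function space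
    are then generated by the coordinates.\<close>
  proof (rule measurable_coordinatewise_then_product)
    fix j show "(\<lambda>\<omega>. if j \<in> J then X j \<omega> else 0) \<in> borel_measurable M"
      using X[of j] by (cases "j \<in> J") auto
  qed
qed

lemma trig_poly_integrable:
  fixes X :: "'i \<Rightarrow> 'a \<Rightarrow> real"
  assumes "prob_space M" and X[measurable]: "\<And>j. j \<in> J \<Longrightarrow> X j \<in> borel_measurable M"
    and "P \<in> trig_poly J"
  shows "integrable M (\<lambda>\<omega>. P (\<lambda>j. X j \<omega>))"
proof -
  interpret prob_space M by fact
  show ?thesis using assms(3)
  proof induction
    case (cos r t b)
    show ?case
      by (rule integrable_const_bound[of _ "\<bar>r\<bar>"]) (auto simp: abs_mult mult_left_le)
  qed simp
qed

text \<open>A continuous substitute for the indicator of |x| > K, rising from 0 at |x| = K to 1 at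
  |x| = K + 1. Continuity makes it an admissible test function for weak convergence.\<close>

definition ramp :: "nat \<Rightarrow> real \<Rightarrow> real" where
  "ramp K x = min 1 (max 0 (\<bar>x\<bar> - real K))"

lemma isCont_ramp: "isCont (ramp K) x"
  unfolding ramp_def[abs_def] by (intro continuous_intros)

lemma measurable_ramp[measurable]: "ramp K \<in> borel_measurable borel"
  unfolding ramp_def[abs_def] by measurable

lemma ramp_bounds: "0 \<le> ramp K x" "ramp K x \<le> 1"
  by (auto simp: ramp_def)

lemma ramp_eq_1: "\<bar>x\<bar> > real K + 1 \<Longrightarrow> ramp K x = 1"
  by (auto simp: ramp_def)

lemma ramp_tendsto_0: "(\<lambda>K. ramp K x) \<longlonglongrightarrow> 0"
proof (rule tendsto_eventually)
  show "\<forall>\<^sub>F K in sequentially. ramp K x = 0"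
    using eventually_ge_at_top[of "nat \<lceil>\<bar>x\<bar>\<rceil>"]
    by eventually_elim (auto simp: ramp_def nat_le_iff ceiling_le_iff)
qed

lemma (in prob_space) integrable_ramp:
  "Z \<in> borel_measurable M \<Longrightarrow> integrable M (\<lambda>\<omega>. ramp K (Z \<omega>))"
  by (rule integrable_const_bound[of _ 1]) (auto simp: ramp_bounds)

lemma (in prob_space) expectation_diff_le:
  fixes f g h :: "'a \<Rightarrow> real"
  assumes int: "integrable M f" "integrable M g" "integrable M h"
    and le: "\<And>\<omega>. \<bar>f \<omega> - g \<omega>\<bar> \<le> e + h \<omega>"
  shows "\<bar>expectation f - expectation g\<bar> \<le> e + expectation h"
proof -
  have "\<bar>expectation f - expectation g\<bar> = \<bar>expectation (\<lambda>\<omega>. f \<omega> - g \<omega>)\<bar>"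
    using int by simp
  also have "\<dots> \<le> expectation (\<lambda>\<omega>. \<bar>f \<omega> - g \<omega>\<bar>)"
    by (rule integral_abs_bound)
  also have "\<dots> \<le> expectation (\<lambda>\<omega>. e + h \<omega>)"
    by (intro integral_mono) (use int le in auto)
  also have "\<dots> = e + expectation h"
    using int prob_space by simp
  finally show ?thesis .
qed

text \<open>\<open>G\<close> is replaced by a trigonometric polynomial, whose expectations converge
  by hypothesis. The error is small on a large cube, and outside it is bounded by a multiple of the
  ramps, whose expectations also converge, as they involve single coordinates. Tightness thus comes
  from the marginals.\<close>

theorem cramer_wold:
  fixes X :: "nat \<Rightarrow> 'i::countable \<Rightarrow> 'a \<Rightarrow> real" and Y :: "'i \<Rightarrow> 'b \<Rightarrow> real"
    and G :: "('i \<Rightarrow> real) \<Rightarrow> real"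
  assumes M: "prob_space M" and M': "prob_space M'" and J: "finite J"
    and X[measurable]: "\<And>N j. j \<in> J \<Longrightarrow> X N j \<in> borel_measurable M"
    and Y[measurable]: "\<And>j. j \<in> J \<Longrightarrow> Y j \<in> borel_measurable M'"
    and conv: "\<And>t (f :: real \<Rightarrow> real). (\<And>x. isCont f x) \<Longrightarrow> (\<And>x. \<bar>f x\<bar> \<le> 1) \<Longrightarrow>
      (\<lambda>N. \<integral>\<omega>. f (\<Sum>j\<in>J. t j * X N j \<omega>) \<partial>M) \<longlonglongrightarrow> (\<integral>\<omega>. f (\<Sum>j\<in>J. t j * Y j \<omega>) \<partial>M')"
    and G: "continuous_on UNIV G" and B: "\<And>x. \<bar>G x\<bar> \<le> B"
  shows "(\<lambda>N. \<integral>\<omega>. G (\<lambda>j. if j \<in> J then X N j \<omega> else 0) \<partial>M)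
           \<longlonglongrightarrow> (\<integral>\<omega>. G (\<lambda>j. if j \<in> J then Y j \<omega> else 0) \<partial>M')"
proof (rule LIMSEQ_I)
  fix r :: real assume "r > 0"
  \<comment> \<open>Five errors add up: \<open>e\<close> plus a tail below \<open>e\<close> for
    \<open>X N\<close>, the same for \<open>Y\<close>, and \<open>e\<close> for the difference of
    the expectations of \<open>P\<close>.\<close>
  define e where "e = r / 5"
  have e: "e > 0" using \<open>r > 0\<close> by (simp add: e_def)
  interpret M: prob_space M by fact
  interpret M': prob_space M' by fact
  have B0: "B \<ge> 0" using B[of undefined] by linarith
  \<comment> \<open>Two values of \<open>G\<close> differ by at most 2B, and the sum of the ramps is
    at least 1 as soon as some coordinate exceeds K + 1 in absolute value.\<close>
  define H where "H K x = 2 * B * (\<Sum>j\<in>J. ramp K (x j))" for K and x :: "'i \<Rightarrow> real"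
  have HX: "integrable M (\<lambda>\<omega>. H K (\<lambda>j. X N j \<omega>))"
      "(\<integral>\<omega>. H K (\<lambda>j. X N j \<omega>) \<partial>M) = 2 * B * (\<Sum>j\<in>J. \<integral>\<omega>. ramp K (X N j \<omega>) \<partial>M)" for N K
    unfolding H_def by (auto simp: M.integrable_ramp)
  have HY: "integrable M' (\<lambda>\<omega>. H K (\<lambda>j. Y j \<omega>))"
      "(\<integral>\<omega>. H K (\<lambda>j. Y j \<omega>) \<partial>M') = 2 * B * (\<Sum>j\<in>J. \<integral>\<omega>. ramp K (Y j \<omega>) \<partial>M')" for K
    unfolding H_def by (auto simp: M'.integrable_ramp)
  \<comment> \<open>The cutoff \<open>K\<close> is chosen for the limit alone; with \<open>K\<close>
    fixed, weak convergence then passes the tail bound on to \<open>X N\<close> for all large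
    N.\<close>
  have "(\<lambda>K. \<integral>\<omega>. ramp K (Y j \<omega>) \<partial>M') \<longlonglongrightarrow> (\<integral>\<omega>. 0 \<partial>M')" if "j \<in> J" for j
    by (rule integral_dominated_convergence[where w = "\<lambda>_. 1"])
       (use that ramp_bounds in \<open>auto intro!: ramp_tendsto_0\<close>)
  then have "(\<lambda>K. 2 * B * (\<Sum>j\<in>J. \<integral>\<omega>. ramp K (Y j \<omega>) \<partial>M')) \<longlonglongrightarrow> 2 * B * (\<Sum>j\<in>J. \<integral>\<omega>. 0 \<partial>M')"
    by (intro tendsto_intros)
  then have "(\<lambda>K. \<integral>\<omega>. H K (\<lambda>j. Y j \<omega>) \<partial>M') \<longlonglongrightarrow> 0"
    by (simp add: HY)
  from order_tendstoD(2)[OF this e]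
  obtain K where K: "(\<integral>\<omega>. H K (\<lambda>j. Y j \<omega>) \<partial>M') < e"
    by (auto simp: eventually_sequentially)
  have "(\<lambda>N. \<integral>\<omega>. ramp K (X N j \<omega>) \<partial>M) \<longlonglongrightarrow> (\<integral>\<omega>. ramp K (Y j \<omega>) \<partial>M')" if "j \<in> J" for j
  proof -
    \<comment> \<open>A unit vector as coefficient vector extracts the marginal of a single
      coordinate.\<close>
    have "(\<Sum>i\<in>J. (if i = j then 1 else 0) * z i) = z j" for z :: "'i \<Rightarrow> real"
      using J that by (simp add: if_distrib[of "\<lambda>y. y * _"] cong: if_cong)
    then show ?thesis
      using conv[of "ramp K" "\<lambda>i. if i = j then 1 else 0"] isCont_ramp ramp_bounds by simp
  qed
  then have "(\<lambda>N. \<integral>\<omega>. H K (\<lambda>j. X N j \<omega>) \<partial>M) \<longlonglongrightarrow> (\<integral>\<omega>. H K (\<lambda>j. Y j \<omega>) \<partial>M')"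
    by (auto simp: HX HY intro!: tendsto_intros)
  from order_tendstoD(2)[OF this K]
  have ev1: "\<forall>\<^sub>F N in sequentially. (\<integral>\<omega>. H K (\<lambda>j. X N j \<omega>) \<partial>M) < e" .
  \<comment> \<open>With this scaling |x| <= K + 1 means |c x| <= pi/2, the range on which arcsin
    inverts sin; K + 1 is where \<open>ramp K\<close> reaches 1.\<close>
  define c where "c = pi / (2 * (real K + 1))"
  have c: "c > 0" by (simp add: c_def)
  obtain P where P: "P \<in> trig_poly J"
    and Pe: "\<And>x. \<bar>G (\<lambda>j. if j \<in> J then arcsin (sin (c * x j)) / c else 0) - P x\<bar> < e"
    by (rule trig_poly_approx[OF J G c e], rule that)
  have key: "\<bar>G (\<lambda>j. if j \<in> J then x j else 0) - P x\<bar> \<le> e + H K x" for x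
  proof (cases "\<forall>j\<in>J. \<bar>x j\<bar> \<le> real K + 1")
    case True
    have "arcsin (sin (c * x j)) / c = x j" if "j \<in> J" for j
    proof -
      have "\<bar>c * x j\<bar> \<le> c * (real K + 1)" using True that c by (auto simp: abs_mult)
      also have "\<dots> = pi / 2" unfolding c_def by (simp add: field_simps)
      finally have "arcsin (sin (c * x j)) = c * x j" by (intro arcsin_sin) auto
      then show ?thesis using c by simp
    qed
    then have "(\<lambda>j. if j \<in> J then arcsin (sin (c * x j)) / c else 0) = (\<lambda>j. if j \<in> J then x j else 0)"
      by auto
    moreover have "0 \<le> H K x" unfolding H_def using B0 by (simp add: sum_nonneg ramp_bounds)
    ultimately show ?thesis using Pe[of x] by simp
  next
    \<comment> \<open>\<open>P\<close> still approximates \<open>G\<close> within \<open>e\<close>,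
      but at the folded point instead of x; \<open>H\<close> pays for moving between the two
      points.\<close>
    case False
    then obtain j where j: "j \<in> J" "\<bar>x j\<bar> > real K + 1" by force
    have "1 \<le> (\<Sum>j\<in>J. ramp K (x j))"
      using member_le_sum[of j J "\<lambda>j. ramp K (x j)"] J j ramp_bounds ramp_eq_1[of K "x j"] by auto
    then have "2 * B * 1 \<le> H K x" unfolding H_def using B0 by (intro mult_left_mono) auto
    then show ?thesis
      using Pe[of x] B[of "\<lambda>j. if j \<in> J then x j else 0"]
        B[of "\<lambda>j. if j \<in> J then arcsin (sin (c * x j)) / c else 0"] by linarith
  qed
  have diffX: "\<bar>(\<integral>\<omega>. G (\<lambda>j. if j \<in> J then X N j \<omega> else 0) \<partial>M) - (\<integral>\<omega>. P (\<lambda>j. X N j \<omega>) \<partial>M)\<bar>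
      \<le> e + (\<integral>\<omega>. H K (\<lambda>j. X N j \<omega>) \<partial>M)" for N
  proof (rule M.expectation_diff_le[OF _ trig_poly_integrable[OF M X P] HX(1) key])
    show "integrable M (\<lambda>\<omega>. G (\<lambda>j. if j \<in> J then X N j \<omega> else 0))"
      by (rule M.integrable_const_bound[of _ B]) (auto simp: B intro: measurable_padded[OF X G])
  qed
  have diffY: "\<bar>(\<integral>\<omega>. G (\<lambda>j. if j \<in> J then Y j \<omega> else 0) \<partial>M') - (\<integral>\<omega>. P (\<lambda>j. Y j \<omega>) \<partial>M')\<bar>
      \<le> e + (\<integral>\<omega>. H K (\<lambda>j. Y j \<omega>) \<partial>M')"
  proof (rule M'.expectation_diff_le[OF _ trig_poly_integrable[OF M' Y P] HY(1) key])
    show "integrable M' (\<lambda>\<omega>. G (\<lambda>j. if j \<in> J then Y j \<omega> else 0))"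
      by (rule M'.integrable_const_bound[of _ B]) (auto simp: B intro: measurable_padded[OF Y G])
  qed
  have "(\<lambda>N. \<integral>\<omega>. P (\<lambda>j. X N j \<omega>) \<partial>M) \<longlonglongrightarrow> (\<integral>\<omega>. P (\<lambda>j. Y j \<omega>) \<partial>M')"
    using P
  proof induction
    case (cos r t b)
    have "(\<lambda>N. \<integral>\<omega>. cos ((\<Sum>j\<in>J. t j * X N j \<omega>) + b) \<partial>M)
            \<longlonglongrightarrow> (\<integral>\<omega>. cos ((\<Sum>j\<in>J. t j * Y j \<omega>) + b) \<partial>M')"
      by (rule conv[of "\<lambda>x. cos (x + b)"]) (auto intro!: continuous_intros)
    then show ?case by (simp add: tendsto_mult_left)
  next
    case (add f g)
    then show ?case
      using trig_poly_integrable[OF M X] trig_poly_integrable[OF M' Y]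
      by (subst (1 2) Bochner_Integration.integral_add) (auto intro!: tendsto_add)
  qed
  from LIMSEQ_D[OF this e]
  have ev2: "\<forall>\<^sub>F N in sequentially.
      \<bar>(\<integral>\<omega>. P (\<lambda>j. X N j \<omega>) \<partial>M) - (\<integral>\<omega>. P (\<lambda>j. Y j \<omega>) \<partial>M')\<bar> < e"
    by (auto simp: eventually_sequentially)
  have "\<forall>\<^sub>F N in sequentially. norm ((\<integral>\<omega>. G (\<lambda>j. if j \<in> J then X N j \<omega> else 0) \<partial>M)
           - (\<integral>\<omega>. G (\<lambda>j. if j \<in> J then Y j \<omega> else 0) \<partial>M')) < r"
    using ev1 ev2
  proof eventually_elim
    case (elim N)
    show ?case
      using elim K diffX[of N] diffY unfolding e_def real_norm_def
      by linarith
  qed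
  then show "\<exists>no. \<forall>N\<ge>no. norm ((\<integral>\<omega>. G (\<lambda>j. if j \<in> J then X N j \<omega> else 0) \<partial>M)
           - (\<integral>\<omega>. G (\<lambda>j. if j \<in> J then Y j \<omega> else 0) \<partial>M')) < r"
    by (simp add: eventually_sequentially)
qed

text \<open>A test function g on the product over \<open>J\<close> is extended to the whole function
  space by precomposing with restriction to \<open>J\<close>. This stays continuous and bounded, and
  it ignores the zeros used as padding in \<open>cramer_wold\<close>.\<close>

lemma fdd_convergenceI:
  fixes X :: "nat \<Rightarrow> 'i::countable \<Rightarrow> 'a \<Rightarrow> real" and Y :: "'i \<Rightarrow> 'b \<Rightarrow> real"
  assumes M: "prob_space M" and M': "prob_space M'"
    and X: "\<And>N i. i \<in> I \<Longrightarrow> X N i \<in> borel_measurable M"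
    and Y: "\<And>i. i \<in> I \<Longrightarrow> Y i \<in> borel_measurable M'"
    and conv: "\<And>J t (f :: real \<Rightarrow> real). finite J \<Longrightarrow> J \<subseteq> I \<Longrightarrow>
      (\<And>x. isCont f x) \<Longrightarrow> (\<And>x. \<bar>f x\<bar> \<le> 1) \<Longrightarrow>
      (\<lambda>N. \<integral>\<omega>. f (\<Sum>j\<in>J. t j * X N j \<omega>) \<partial>M) \<longlonglongrightarrow> (\<integral>\<omega>. f (\<Sum>j\<in>J. t j * Y j \<omega>) \<partial>M')"
  shows "fdd_convergence I M X M' Y"
  unfolding fdd_convergence_def
proof (intro conjI ballI allI impI)
  fix J g
  assume "finite J \<and> J \<subseteq> I \<and> continuous_map (product_topology (\<lambda>_. euclideanreal) J) euclideanreal g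
    \<and> bounded (g ` (J \<rightarrow>\<^sub>E UNIV))"
  then have J: "finite J" "J \<subseteq> I"
    and g: "continuous_map (product_topology (\<lambda>_. euclideanreal) J) euclideanreal g"
    and "bounded (g ` (J \<rightarrow>\<^sub>E UNIV))" by auto
  then obtain B where B: "\<And>x. x \<in> J \<rightarrow>\<^sub>E UNIV \<Longrightarrow> \<bar>g x\<bar> \<le> B"
    unfolding bounded_iff by (auto simp: real_norm_def)
  define G where "G x = g (restrict x J)" for x :: "'i \<Rightarrow> real"
  have "continuous_map (product_topology (\<lambda>_. euclideanreal) UNIV)
          (product_topology (\<lambda>_. euclideanreal) J) (\<lambda>x. restrict x J)"
    unfolding continuous_map_componentwise
    by (auto intro: continuous_map_product_projection)
  from continuous_map_compose[OF this g] have G: "continuous_on UNIV G"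
    by (simp add: G_def[abs_def] comp_def euclidean_product_topology)
  have GB: "\<bar>G x\<bar> \<le> B" for x unfolding G_def by (rule B) auto
  have eq: "G (\<lambda>j. if j \<in> J then z j else 0) = g (\<lambda>j\<in>J. z j)" for z
    unfolding G_def by (rule arg_cong[where f = g]) (auto simp: restrict_def)
  show "(\<lambda>N. \<integral>\<omega>. g (\<lambda>i\<in>J. X N i \<omega>) \<partial>M) \<longlonglongrightarrow> (\<integral>\<omega>. g (\<lambda>i\<in>J. Y i \<omega>) \<partial>M')"
    unfolding eq[symmetric]
    by (rule cramer_wold[OF M M' J(1) _ _ _ G GB]) (use J X Y conv in auto)
qed (use X Y in auto)


section \<open>The central limit theorem for a function of a discrete sample\<close>

text \<open>Bridges the numbering of samples from 1 and the central limit theorem for sequences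
  indexed from 0. Events chosen along \<open>J\<close> become events along the image of
  \<open>J\<close> through the inverse of f, where injectivity is used.\<close>

lemma (in prob_space) indep_vars_reindex:
  assumes inj: "inj_on f I" and ind: "indep_vars M' X (f ` I)"
  shows "indep_vars (M' \<circ> f) (X \<circ> f) I"
  unfolding indep_vars_def2
proof (intro conjI indep_setsI)
  have rv: "X (f i) \<in> measurable M (M' (f i))" if "i \<in> I" for i
    using ind that unfolding indep_vars_def2 by blast
  then show "\<forall>i\<in>I. random_variable ((M' \<circ> f) i) ((X \<circ> f) i)" by simp
  show "{(X \<circ> f) i -` A \<inter> space M |A. A \<in> sets ((M' \<circ> f) i)} \<subseteq> events" if "i \<in> I" for i
    using rv[OF that] by (auto intro: measurable_sets)
  fix A J assume J: "J \<noteq> {}" "J \<subseteq> I" "finite J"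
    and A: "\<forall>j\<in>J. A j \<in> {(X \<circ> f) j -` A \<inter> space M |A. A \<in> sets ((M' \<circ> f) j)}"
  have injJ: "inj_on f J" using inj J(2) by (rule inj_on_subset)
  let ?A = "\<lambda>k. A (the_inv_into J f k)"
  have inv: "?A (f j) = A j" if "j \<in> J" for j
    using the_inv_into_f_f[OF injJ that] by simp
  have "prob (\<Inter>k\<in>f ` J. ?A k) = (\<Prod>k\<in>f ` J. prob (?A k))"
    by (rule indep_setsD[OF ind[unfolded indep_vars_def2, THEN conjunct2]])
       (use J A inv in auto)
  then show "prob (\<Inter>j\<in>J. A j) = (\<Prod>j\<in>J. prob (A j))"
    by (simp add: prod.reindex[OF injJ] inv cong: prod.cong INF_cong)
qed

text \<open>The classical theorem divides by the standard deviation, so \<open>V = 0\<close> is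
  treated apart: then h is almost surely equal to its mean under p, and both sides reduce to
  \<open>f 0\<close>.\<close>

theorem clt_pmf_sample:
  fixes X :: "nat \<Rightarrow> 'a \<Rightarrow> nat" and p :: "nat pmf"
    and h :: "nat \<Rightarrow> real" and f :: "real \<Rightarrow> real"
  assumes M: "prob_space M"
    and indep: "prob_space.indep_vars M (\<lambda>_. count_space UNIV) X {1..}"
    and law: "\<And>k. k \<ge> 1 \<Longrightarrow> distr M (count_space UNIV) (X k) = measure_pmf p"
    and h: "integrable (measure_pmf p) (\<lambda>s. (h s)\<^sup>2)"
    and f: "\<And>x. isCont f x" "\<And>x. \<bar>f x\<bar> \<le> 1"
  defines "m \<equiv> measure_pmf.expectation p h"
    and "V \<equiv> measure_pmf.expectation p (\<lambda>s. (h s)\<^sup>2) - (measure_pmf.expectation p h)\<^sup>2"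
  shows "(\<lambda>N. \<integral>\<omega>. f (sqrt (real N) * ((1 / real N) * (\<Sum>k = 1..N. h (X k \<omega>)) - m)) \<partial>M)
           \<longlonglongrightarrow> integral\<^sup>L (normal_law 0 (sqrt V)) f"
proof -
  interpret prob_space M by fact
  have X[measurable]: "X k \<in> measurable M (count_space UNIV)" if "k \<ge> 1" for k
    using indep that unfolding indep_vars_def by auto
  have f_meas[measurable]: "f \<in> borel_measurable borel"
    by (intro borel_measurable_continuous_onI continuous_at_imp_continuous_on) (use f in auto)
  have h1: "integrable (measure_pmf p) h"
    by (rule measure_pmf.square_integrable_imp_integrable[OF _ h]) simp
  have V: "V = measure_pmf.variance p h"
    unfolding V_def by (subst measure_pmf.variance_eq[OF h1 h]) simp
  have push: "integrable M (\<lambda>\<omega>. g (X k \<omega>)) \<longleftrightarrow> integrable (measure_pmf p) g"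
       "expectation (\<lambda>\<omega>. g (X k \<omega>)) = measure_pmf.expectation p g"
    if "k \<ge> 1" for k and g :: "nat \<Rightarrow> real"
    unfolding law[OF that, symmetric] using that
    by (auto simp: integrable_distr_eq integral_distr)
  \<comment> \<open>Also true for N = 0, where both sides are 0 by the conventions for
    division.\<close>
  have avg: "sqrt (real N) * ((1 / real N) * (\<Sum>k = 1..N. h (X k \<omega>)) - m)
      = (\<Sum>i<N. h (X (Suc i) \<omega>) - m) / sqrt (real N)" for N \<omega>
  proof (cases "N = 0")
    case False
    have "(\<Sum>k = 1..N. h (X k \<omega>)) = (\<Sum>i<N. h (X (Suc i) \<omega>))"
      by (rule sum.reindex_bij_witness[of _ Suc "\<lambda>k. k - 1"]) auto
    moreover have "sqrt (real N) * ((1 / real N) * z - m) = (z - real N * m) / sqrt (real N)" for z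
      using False by (simp add: field_simps)
    ultimately show ?thesis by (simp add: sum_subtractf)
  qed simp
  show ?thesis
  proof (cases "V = 0")
    case True
    have "AE s in measure_pmf p. (h s - m)\<^sup>2 = 0"
    proof (subst integral_nonneg_eq_0_iff_AE[symmetric])
      show "integrable (measure_pmf p) (\<lambda>s. (h s - m)\<^sup>2)"
        using h h1 by (simp add: power2_diff)
      show "(\<integral>s. (h s - m)\<^sup>2 \<partial>measure_pmf p) = 0" using V True by (simp add: m_def)
    qed auto
    then have ae: "AE s in measure_pmf p. h s = m" by simp
    have "AE \<omega> in M. h (X (Suc i) \<omega>) = m" for i
      using ae unfolding law[of "Suc i", simplified, symmetric]
      by (subst (asm) AE_distr_iff) auto
    then have "AE \<omega> in M. \<forall>i. h (X (Suc i) \<omega>) = m" by (simp add: AE_all_countable)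
    then have "(\<integral>\<omega>. f ((\<Sum>i<N. h (X (Suc i) \<omega>) - m) / sqrt (real N)) \<partial>M) = (\<integral>\<omega>. f 0 \<partial>M)" for N
      by (intro integral_cong_AE) (auto elim!: eventually_mono)
    moreover have "integral\<^sup>L (normal_law 0 (sqrt V)) f = f 0"
      unfolding True by (simp flip: return_eq_normal_law add: integral_return)
    ultimately show ?thesis unfolding avg using prob_space by simp
  next
    case False
    have "V \<ge> 0" unfolding V by (rule measure_pmf.variance_positive)
    with False have V0: "V > 0" by simp
    let ?S = "\<lambda>n \<omega>. (\<Sum>i<n. h (X (Suc i) \<omega>) - m) / sqrt (real n * (sqrt V)\<^sup>2)"
    have "weak_conv_m (\<lambda>n. distr M borel (?S n)) std_normal_distribution"
    proof (rule central_limit_theorem)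
      have "indep_vars (\<lambda>_. count_space UNIV) (\<lambda>i. X (Suc i)) UNIV"
        using indep_vars_reindex[of Suc UNIV "\<lambda>_. count_space UNIV" X]
          indep_vars_subset[OF indep, of "range Suc"] by (simp add: comp_def image_subset_iff)
      then show "indep_vars (\<lambda>i. borel) (\<lambda>i \<omega>. h (X (Suc i) \<omega>)) UNIV"
        by (rule indep_vars_compose2) auto
      show "expectation (\<lambda>\<omega>. h (X (Suc n) \<omega>)) = m" for n
        by (simp add: push m_def)
      show "sqrt V > 0" using V0 by simp
      show "integrable M (\<lambda>\<omega>. (h (X (Suc n) \<omega>))\<^sup>2)" for n
        using push(1)[of "Suc n" "\<lambda>s. (h s)\<^sup>2"] h by simp
      show "variance (\<lambda>\<omega>. h (X (Suc n) \<omega>)) = (sqrt V)\<^sup>2" for n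
        using push(2)[of "Suc n" "\<lambda>s. (h s - m)\<^sup>2"] V0 by (simp add: push m_def V)
      show "distr M borel (\<lambda>\<omega>. h (X (Suc n) \<omega>)) = distr (measure_pmf p) borel h" for n
        unfolding law[of "Suc n", simplified, symmetric]
        by (subst distr_distr) (auto simp: comp_def)
    qed
    \<comment> \<open>Rescaling the test function undoes the normalisation to unit variance.\<close>
    then have "(\<lambda>n. \<integral>x. f (sqrt V * x) \<partial>distr M borel (?S n))
        \<longlonglongrightarrow> (\<integral>x. f (sqrt V * x) \<partial>std_normal_distribution)"
    proof (rule weak_conv_imp_integral_bdd_continuous_conv[rotated 2])
      show "real_distribution (distr M borel (?S n))" for n
        by (intro real_distribution_distr) auto
      show "isCont (\<lambda>x. f (sqrt V * x)) x" for x
        by (intro isCont_o2[OF _ f(1)] continuous_intros)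
      show "norm (f (sqrt V * x)) \<le> 1" for x using f(2) by simp
    qed (rule real_dist_normal_dist)
    moreover have "sqrt V * ?S n \<omega> = (\<Sum>i<n. h (X (Suc i) \<omega>) - m) / sqrt (real n)" for n \<omega>
      using V0 by (simp add: real_sqrt_mult)
    moreover have "(\<integral>x. f (sqrt V * x) \<partial>std_normal_distribution) = integral\<^sup>L (normal_law 0 (sqrt V)) f"
      unfolding normal_law_def by (subst integral_distr) auto
    ultimately show ?thesis
      unfolding avg by (simp add: integral_distr)
  qed
qed


section \<open>The coefficients of the inversion operator\<close>

text \<open>Extended by 0 to s < w, so that the series for different w share the index s and can be
  combined term by term.\<close>

definition S_coeff :: "real \<Rightarrow> nat \<Rightarrow> nat \<Rightarrow> real" where
  "S_coeff q w s = (if s < w then 0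
     else real (s choose w) * ((-1) ^ (s - w) / q ^ s) * (1 - q) ^ (s - w))"

lemma S_term_eq: "S_term q x w j = S_coeff q w (j + w) * x (j + w)"
  by (simp add: S_term_def S_coeff_def add.commute)

lemma S_coeff_less: "s < w \<Longrightarrow> S_coeff q w s = 0"
  by (simp add: S_coeff_def)

lemma summable_S_term_iff:
  "summable (S_term q x w) \<longleftrightarrow> summable (\<lambda>s. S_coeff q w s * x s)"
  unfolding S_term_eq[abs_def] by (rule summable_iff_shift)

lemma S_term_sums_iff:
  "S_term q x w sums y \<longleftrightarrow> (\<lambda>s. S_coeff q w s * x s) sums y"
  unfolding S_term_eq[abs_def]
  using sums_iff_shift[of "\<lambda>s. S_coeff q w s * x s" w y] by (simp add: S_coeff_less)

lemma S_op_eq: "(\<lambda>s. S_coeff q w s * x s) sums y \<Longrightarrow> S_op q x w = y"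
  unfolding S_op_def S_term_sums_iff[symmetric] by (rule sums_unique[symmetric])

text \<open>For each sample the indicator sequence has a single nonzero entry, so the series over s
  exchanges with the finite sum over the samples.\<close>

lemma est_pmf_eq:
  "est_pmf q X N \<omega> w = (1 / real N) * (\<Sum>k = 1..N. S_coeff q w (X k \<omega>))"
  unfolding est_pmf_def
proof (rule S_op_eq)
  have "(\<lambda>s. S_coeff q w s * (if X k \<omega> = s then 1 else 0)) sums S_coeff q w (X k \<omega>)" for k
    using sums_single[of "X k \<omega>" "S_coeff q w"]
    by (rule sums_cong[THEN iffD1, rotated]) auto
  then have "(\<lambda>s. (1 / real N) * (\<Sum>k = 1..N. S_coeff q w s * (if X k \<omega> = s then 1 else 0)))
      sums ((1 / real N) * (\<Sum>k = 1..N. S_coeff q w (X k \<omega>)))"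
    by (intro sums_mult sums_sum)
  moreover have "(\<lambda>s. (1 / real N) * (\<Sum>k = 1..N. S_coeff q w s * (if X k \<omega> = s then 1 else 0)))
      = (\<lambda>s. S_coeff q w s * emp_pmf X N \<omega> s)"
    unfolding emp_pmf_def
    by (simp only: sum_distrib_left[symmetric] mult.left_commute)
  ultimately show "(\<lambda>s. S_coeff q w s * emp_pmf X N \<omega> s)
      sums ((1 / real N) * (\<Sum>k = 1..N. S_coeff q w (X k \<omega>)))" by simp
qed

section \<open>Expectations under mixtures and binomial inversion\<close>

lemma pmf_expectation_suminf:
  fixes f :: "nat \<Rightarrow> real"
  assumes "summable (\<lambda>s. \<bar>f s\<bar> * pmf p s)"
  shows "integrable (measure_pmf p) f"
    and "measure_pmf.expectation p f = (\<Sum>s. f s * pmf p s)"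
proof -
  have int: "integrable (count_space UNIV) (\<lambda>s. pmf p s *\<^sub>R f s)"
    using assms by (simp add: integrable_count_space_nat_iff abs_mult mult.commute)
  show "integrable (measure_pmf p) f"
    unfolding measure_pmf_eq_density by (subst integrable_density) (use int in auto)
  show "measure_pmf.expectation p f = (\<Sum>s. f s * pmf p s)"
    unfolding measure_pmf_eq_density
    by (subst integral_density) (use int in \<open>auto simp: integral_count_space_nat mult.commute\<close>)
qed

lemma expectation_bind_pmf_nonneg:
  fixes f :: "'b \<Rightarrow> real"
  assumes int: "integrable (bind_pmf W K) f" and nonneg: "\<And>x. f x \<ge> 0"
    and fin: "\<And>w. finite (set_pmf (K w))"
  shows "integrable W (\<lambda>w. measure_pmf.expectation (K w) f)"
    and "measure_pmf.expectation (bind_pmf W K) f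
           = measure_pmf.expectation W (\<lambda>w. measure_pmf.expectation (K w) f)"
proof -
  have "ennreal (measure_pmf.expectation (bind_pmf W K) f) = (\<integral>\<^sup>+x. f x \<partial>bind_pmf W K)"
    by (rule nn_integral_eq_integral[symmetric]) (use int nonneg in auto)
  also have "\<dots> = (\<integral>\<^sup>+w. (\<integral>\<^sup>+x. f x \<partial>K w) \<partial>W)" by simp
  also have "\<dots> = (\<integral>\<^sup>+w. ennreal (measure_pmf.expectation (K w) f) \<partial>W)"
    by (intro nn_integral_cong nn_integral_eq_integral integrable_measure_pmf_finite fin) (use nonneg in auto)
  finally have eq: "(\<integral>\<^sup>+w. ennreal (measure_pmf.expectation (K w) f) \<partial>W)
      = ennreal (measure_pmf.expectation (bind_pmf W K) f)" ..
  show i: "integrable W (\<lambda>w. measure_pmf.expectation (K w) f)"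
    by (rule integrableI_nonneg) (use nonneg eq in auto)
  have "ennreal (measure_pmf.expectation W (\<lambda>w. measure_pmf.expectation (K w) f))
      = ennreal (measure_pmf.expectation (bind_pmf W K) f)"
    unfolding eq[symmetric] by (rule nn_integral_eq_integral[symmetric]) (use i nonneg in auto)
  then show "measure_pmf.expectation (bind_pmf W K) f
           = measure_pmf.expectation W (\<lambda>w. measure_pmf.expectation (K w) f)"
    using nonneg by (simp add: integral_nonneg)
qed

text \<open>The tower property, split into positive and negative parts. Finite support of each
  \<open>K w\<close> makes the inner expectations unproblematic; only integrability under the
  mixture is at stake.\<close>

lemma expectation_bind_pmf:
  fixes f :: "'b \<Rightarrow> real"
  assumes int: "integrable (bind_pmf W K) f" and fin: "\<And>w. finite (set_pmf (K w))"
  shows "measure_pmf.expectation (bind_pmf W K) f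
           = measure_pmf.expectation W (\<lambda>w. measure_pmf.expectation (K w) f)"
proof -
  define g h where "g x = max 0 (f x)" and "h x = max 0 (- f x)" for x
  have f: "f = (\<lambda>x. g x - h x)" by (auto simp: g_def h_def)
  have i: "integrable (bind_pmf W K) g" "integrable (bind_pmf W K) h"
    using int by (auto simp: g_def[abs_def] h_def[abs_def])
  have n: "\<And>x. g x \<ge> 0" "\<And>x. h x \<ge> 0" by (auto simp: g_def h_def)
  have k: "integrable (K w) u" for w and u :: "'b \<Rightarrow> real"
    by (rule integrable_measure_pmf_finite[OF fin])
  show ?thesis unfolding f
    by (simp add: i k expectation_bind_pmf_nonneg[OF i(1) n(1) fin]
          expectation_bind_pmf_nonneg[OF i(2) n(2) fin])
qed

text \<open>The powers of q cancel, those of 1 - q combine to the exponent m - w whatever k is, and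
  C(m,k) C(k,w) = C(m,w) C(m-w,k-w). What remains is the alternating sum of a binomial row, which
  vanishes unless m = w.\<close>

lemma binomial_expectation_S_coeff:
  assumes q: "0 < q" "q < 1"
  shows "measure_pmf.expectation (binomial_pmf m q) (S_coeff q w) = (if m = w then 1 else 0)"
proof -
  have "measure_pmf.expectation (binomial_pmf m q) (S_coeff q w)
      = (\<Sum>k\<le>m. (real (m choose k) * q ^ k * (1 - q) ^ (m - k)) * S_coeff q w k)"
    using q by (subst expectation_binomial_pmf') auto
  also have "\<dots> = (if m = w then 1 else 0)"
  proof (cases "w \<le> m")
    case False
    then have "S_coeff q w k = 0" if "k \<le> m" for k using that by (simp add: S_coeff_def)
    then show ?thesis using False by simp
  next
    case True
    have "(\<Sum>k\<le>m. (real (m choose k) * q ^ k * (1 - q) ^ (m - k)) * S_coeff q w k)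
        = (\<Sum>k\<in>{w..m}. (real (m choose k) * q ^ k * (1 - q) ^ (m - k)) * S_coeff q w k)"
      by (rule sum.mono_neutral_right) (auto simp: S_coeff_def)
    also have "\<dots> = (\<Sum>i\<le>m - w. (real (m choose (i + w)) * q ^ (i + w) * (1 - q) ^ (m - (i + w))) * S_coeff q w (i + w))"
      by (rule sum.reindex_bij_witness[of _ "\<lambda>i. i + w" "\<lambda>k. k - w"]) (use True in auto)
    also have "\<dots> = (\<Sum>i\<le>m - w. real (m choose w) * (1 - q) ^ (m - w) * ((-1) ^ i * real ((m - w) choose i)))"
    proof (rule sum.cong[OF refl])
      fix i assume i: "i \<in> {..m - w}"
      have "(m choose (i + w)) * ((i + w) choose w) = (m choose w) * ((m - w) choose i)"
        using choose_mult[of w "i + w" m] i True by simp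
      then have c: "real (m choose (i + w)) * real ((i + w) choose w) = real (m choose w) * real ((m - w) choose i)"
        by (metis of_nat_mult)
      have e: "(1 - q) ^ (m - (i + w)) * (1 - q) ^ i = (1 - q) ^ (m - w)"
        using i True by (simp flip: power_add)
      have "(real (m choose (i + w)) * q ^ (i + w) * (1 - q) ^ (m - (i + w))) * S_coeff q w (i + w)
          = (real (m choose (i + w)) * real ((i + w) choose w)) * ((1 - q) ^ (m - (i + w)) * (1 - q) ^ i) * (-1) ^ i"
        using q by (simp add: S_coeff_def)
      then show "(real (m choose (i + w)) * q ^ (i + w) * (1 - q) ^ (m - (i + w))) * S_coeff q w (i + w)
          = real (m choose w) * (1 - q) ^ (m - w) * ((-1) ^ i * real ((m - w) choose i))"
        unfolding c e by (simp add: mult_ac)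
    qed
    also have "\<dots> = real (m choose w) * (1 - q) ^ (m - w) * (\<Sum>i\<le>m - w. (-1) ^ i * real ((m - w) choose i))"
      by (simp add: sum_distrib_left)
    also have "\<dots> = (if m = w then 1 else 0)"
      using choose_alternating_sum[of "m - w", where 'a = real] True by auto
    finally show ?thesis .
  qed
  finally show ?thesis .
qed

lemma thinned_pmf_expectation_S_coeff:
  assumes q: "0 < q" "q < 1" and int: "integrable (thinned_pmf q W) (S_coeff q w)"
  shows "measure_pmf.expectation (thinned_pmf q W) (S_coeff q w) = pmf W w"
proof -
  have "measure_pmf.expectation (thinned_pmf q W) (S_coeff q w)
      = measure_pmf.expectation W (\<lambda>m. measure_pmf.expectation (binomial_pmf m q) (S_coeff q w))"
    unfolding thinned_pmf_def
    by (rule expectation_bind_pmf) (use q int in \<open>auto simp: thinned_pmf_def\<close>)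
  also have "\<dots> = measure_pmf.expectation W (indicator {w})"
    unfolding binomial_expectation_S_coeff[OF q]
    by (intro Bochner_Integration.integral_cong) (auto simp: indicator_def)
  also have "\<dots> = pmf W w" by (simp add: measure_pmf_single)
  finally show ?thesis .
qed

lemma
  assumes q: "0 < q" "q < 1" and R: "R_coeff q W w < \<infinity>"
  shows summable_S_coeff_square: "summable (\<lambda>s. (S_coeff q w s)\<^sup>2 * pmf (thinned_pmf q W) s)"
    and R_coeff_eq: "enn2real (R_coeff q W w) = (\<Sum>s. (S_coeff q w s)\<^sup>2 * pmf (thinned_pmf q W) s)"
proof -
  define r where "r s = (S_coeff q w s)\<^sup>2 * pmf (thinned_pmf q W) s" for s
  have r: "(real ((w + j) choose w))\<^sup>2 * (1 - q) ^ (2 * j) / q ^ (2 * (w + j))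
              * pmf (thinned_pmf q W) (w + j) = r (j + w)" for j
  proof -
    have "((-1) ^ j :: real)\<^sup>2 = 1" by (simp flip: power_mult)
    then show ?thesis
      by (simp add: r_def S_coeff_def power_mult_distrib power_divide add.commute
               flip: power_mult) (simp add: mult.commute)
  qed
  have R': "R_coeff q W w = (\<Sum>j. ennreal (r (j + w)))"
    unfolding R_coeff_def r ..
  have pos: "r s \<ge> 0" for s by (simp add: r_def)
  have s: "summable (\<lambda>j. r (j + w))"
    by (rule summable_suminf_not_top) (use R R' pos in auto)
  then show sr: "summable (\<lambda>s. (S_coeff q w s)\<^sup>2 * pmf (thinned_pmf q W) s)"
    unfolding r_def[symmetric] by (subst (asm) summable_iff_shift)
  have "(\<Sum>s. r s) = (\<Sum>j. r (j + w))"
    using suminf_split_initial_segment[of r w] sr by (simp flip: r_def) (simp add: r_def S_coeff_less)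
  moreover have "R_coeff q W w = ennreal (\<Sum>j. r (j + w))"
    unfolding R' by (rule suminf_ennreal2) (use s pos in auto)
  ultimately show "enn2real (R_coeff q W w) = (\<Sum>s. (S_coeff q w s)\<^sup>2 * pmf (thinned_pmf q W) s)"
    using suminf_nonneg[OF s] pos by (simp add: r_def)
qed

text \<open>This is the absorption identity (w + 1) C(s,w+1) = (s - w) C(s,w) at s = j + w + 1:
  raising w by one gains the factor s - w = j + 1.\<close>

lemma S_coeff_Suc:
  "(real j + 1) * \<bar>S_coeff q w (j + Suc w)\<bar>
           = (real w + 1) * \<bar>1 - q\<bar> * \<bar>S_coeff q (Suc w) (j + Suc w)\<bar>"
proof -
  have "Suc w * ((j + Suc w) choose Suc w) = (j + Suc w - w) * ((j + Suc w) choose w)"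
    unfolding binomial_absorption binomial_absorb_comp ..
  then have "real (Suc w) * real ((j + Suc w) choose Suc w) = real (Suc j) * real ((j + Suc w) choose w)"
    by (metis (no_types, lifting) add_Suc_right add_Suc add_diff_cancel_right' of_nat_mult)
  moreover have "\<bar>S_coeff q w (j + Suc w)\<bar>
      = real ((j + Suc w) choose w) * (\<bar>1 - q\<bar> * \<bar>1 - q\<bar> ^ j / \<bar>q\<bar> ^ (j + Suc w))"
    by (simp add: S_coeff_def abs_mult power_abs del: binomial_Suc_Suc)
  moreover have "\<bar>S_coeff q (Suc w) (j + Suc w)\<bar>
      = real ((j + Suc w) choose Suc w) * (\<bar>1 - q\<bar> ^ j / \<bar>q\<bar> ^ (j + Suc w))"
    by (simp add: S_coeff_def abs_mult power_abs del: binomial_Suc_Suc)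
  ultimately show ?thesis
    by (simp add: mult.assoc[symmetric] add.commute del: binomial_Suc_Suc)
qed

text \<open>The factor \<open>s\<^sup>2\<close> needed for Cauchy-Schwarz against \<open>\<Sum> 1 / s\<^sup>2\<close> is supplied by the finiteness of
  the next coefficient \<open>R\<^bsub>q,w+1\<^esub>\<close>.\<close>

lemma summable_S_coeff_sqrt:
  assumes q: "0 < q" "q < 1" and R: "R_coeff q W (Suc w) < \<infinity>"
  shows "summable (\<lambda>s. \<bar>S_coeff q w s\<bar> * sqrt (pmf (thinned_pmf q W) s))"
proof -
  let ?p = "pmf (thinned_pmf q W)" and ?c = "(real w + 1) * \<bar>1 - q\<bar>"
  have "summable (\<lambda>j. ?c\<^sup>2 * ((S_coeff q (Suc w) (j + Suc w))\<^sup>2 * ?p (j + Suc w)) + 1 / (real j + 1)\<^sup>2)"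
  proof (intro summable_add summable_mult)
    show "summable (\<lambda>j. (S_coeff q (Suc w) (j + Suc w))\<^sup>2 * ?p (j + Suc w))"
      using summable_S_coeff_square[OF q R] by (subst summable_iff_shift)
    have "summable (\<lambda>j. inverse ((real (Suc j))\<^sup>2))"
      using inverse_power_summable[of 2, where 'a = real] by (subst summable_Suc_iff) simp
    then show "summable (\<lambda>j. 1 / (real j + 1)\<^sup>2)" by (simp add: field_simps)
  qed
  then have "summable (\<lambda>j. \<bar>S_coeff q w (j + Suc w)\<bar> * sqrt (?p (j + Suc w)))"
  proof (rule summable_comparison_test')
    fix j
    \<comment> \<open>The factor j + 1 is given to \<open>?x\<close> and its reciprocal to
      \<open>?y\<close>; then \<open>?x * ?y\<close> is bounded by the sum of the squares, each of
      which is summable.\<close>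
    let ?x = "(real j + 1) * (\<bar>S_coeff q w (j + Suc w)\<bar> * sqrt (?p (j + Suc w)))"
    let ?y = "1 / (real j + 1)"
    have "\<bar>S_coeff q w (j + Suc w)\<bar> * sqrt (?p (j + Suc w)) = ?x * ?y" by simp
    also have "\<dots> \<le> ?x\<^sup>2 + ?y\<^sup>2"
    proof -
      have "0 \<le> ?x * ?y" "0 \<le> (?x - ?y)\<^sup>2" by simp_all
      moreover have "(?x - ?y)\<^sup>2 = ?x\<^sup>2 + ?y\<^sup>2 - 2 * (?x * ?y)" by (simp only: power2_diff)
      ultimately show ?thesis by linarith
    qed
    also have "?x = ?c * \<bar>S_coeff q (Suc w) (j + Suc w)\<bar> * sqrt (?p (j + Suc w))"
      using S_coeff_Suc[of j q w] by (simp only: mult.assoc[symmetric])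
    also have "\<dots>\<^sup>2 = ?c\<^sup>2 * ((S_coeff q (Suc w) (j + Suc w))\<^sup>2 * ?p (j + Suc w))"
      by (simp only: power_mult_distrib) (simp add: mult.assoc)
    also have "?y\<^sup>2 = 1 / (real j + 1)\<^sup>2" by (simp add: power_divide)
    finally show "norm (\<bar>S_coeff q w (j + Suc w)\<bar> * sqrt (?p (j + Suc w)))
        \<le> ?c\<^sup>2 * ((S_coeff q (Suc w) (j + Suc w))\<^sup>2 * ?p (j + Suc w)) + 1 / (real j + 1)\<^sup>2"
      by simp
  qed
  then show ?thesis by (subst (asm) summable_iff_shift)
qed


section \<open>Convergence of the estimator\<close>

theorem theorem4p1:
  fixes q :: real and W :: "nat pmf"
    and M :: "'a measure" and X :: "nat \<Rightarrow> 'a \<Rightarrow> nat"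
    and M' :: "'b measure" and \<xi> :: "nat \<Rightarrow> 'b \<Rightarrow> real"
  assumes q: "0 < q" "q < 1"
    and W_pos: "0 \<notin> set_pmf W"
    and M: "prob_space M"
    and X_indep: "prob_space.indep_vars M (\<lambda>_. count_space UNIV) X {1..}"
    and X_law: "\<And>k. k \<ge> 1 \<Longrightarrow>
          distr M (count_space UNIV) (X k) = measure_pmf (thinned_pmf q W)"
    and R_fin: "\<And>w. w \<ge> 1 \<Longrightarrow> R_coeff q W w < \<infinity>"
    and M': "prob_space M'"
    and xi_gauss: "gaussian_process M' {1..} \<xi>"
    and xi_mean: "\<And>s. s \<ge> 1 \<Longrightarrow> (\<integral>\<omega>. \<xi> s \<omega> \<partial>M') = 0"
    and xi_cov: "\<And>s t. s \<ge> 1 \<Longrightarrow> t \<ge> 1 \<Longrightarrow>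
          (\<integral>\<omega>. \<xi> s \<omega> * \<xi> t \<omega> \<partial>M') =
            pmf (thinned_pmf q W) s * (if s = t then 1 else 0)
              - pmf (thinned_pmf q W) s * pmf (thinned_pmf q W) t"
  shows "(\<forall>w\<ge>1. AE \<omega> in M'. summable (S_term q (\<lambda>s. \<xi> s \<omega>) w))
    \<and> fdd_convergence {1..}
         M (\<lambda>N w \<omega>. sqrt (real N) * (est_pmf q X N \<omega> w - pmf W w))
         M' (\<lambda>w \<omega>. S_op q (\<lambda>s. \<xi> s \<omega>) w)
    \<and> gaussian_process M' {1..} (\<lambda>w \<omega>. S_op q (\<lambda>s. \<xi> s \<omega>) w)
    \<and> (\<forall>w\<ge>1. (\<integral>\<omega>. S_op q (\<lambda>s. \<xi> s \<omega>) w \<partial>M') = 0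
           \<and> (\<integral>\<omega>. (S_op q (\<lambda>s. \<xi> s \<omega>) w)\<^sup>2 \<partial>M')
               = enn2real (R_coeff q W w) - (pmf W w)\<^sup>2)"
proof -
  interpret M: prob_space M by fact
  interpret \<xi>: multinomial_gaussian M' "thinned_pmf q W" \<xi>
  proof (rule multinomial_gaussian.intro[OF M'], unfold_locales)
  qed (fact xi_gauss xi_mean xi_cov)+
  let ?p = "thinned_pmf q W"
  let ?a = "S_coeff q"
  let ?Y = "\<lambda>w \<omega>. S_op q (\<lambda>s. \<xi> s \<omega>) w"
  have a0: "?a w 0 = 0" if "w \<ge> 1" for w using that by (simp add: S_coeff_def)
  have abs_sum: "summable (\<lambda>s. \<bar>?a w s\<bar> * sqrt (pmf ?p s))" if "w \<ge> 1" for w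
    by (rule summable_S_coeff_sqrt[OF q R_fin]) simp
  have Y_sums: "AE \<omega> in M'. (\<lambda>s. ?a w s * \<xi> s \<omega>) sums ?Y w \<omega>" if "w \<ge> 1" for w
    using \<xi>.AE_summable_series[of "?a w", OF a0[OF that] abs_sum[OF that]]
  proof eventually_elim
    case (elim \<omega>)
    then have sums: "(\<lambda>s. ?a w s * \<xi> s \<omega>) sums (\<Sum>s. ?a w s * \<xi> s \<omega>)"
      by (rule summable_sums[OF summable_rabs_cancel])
    show ?case using sums S_op_eq[OF sums] by simp
  qed
  \<comment> \<open>Measurability holds on the whole space, including the null set where the series
    diverges and \<open>S_op\<close> takes a default value. Only indices w + j >= 1 occur.\<close>
  have Y_meas: "?Y w \<in> borel_measurable M'" if "w \<ge> 1" for w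
  proof -
    have [measurable]: "\<xi> (w + j) \<in> borel_measurable M'" for j
      using \<xi>.measurable_xi that by simp
    show ?thesis unfolding S_op_def S_term_def by measurable
  qed
  have X_meas[measurable]: "X k \<in> measurable M (count_space UNIV)" if "k \<ge> 1" for k
    using X_indep that unfolding M.indep_vars_def by auto

  \<comment> \<open>\<open>b J t\<close> is the function averaged by the combination of estimators
    and also the coefficient sequence of the combined Gaussian series. Its variance
    \<open>V J t\<close> under the thinned law is the common variance of both limits.\<close>
  define b where "b J t s = (\<Sum>w\<in>J. t w * ?a w s)" for J t s
  define V where "V J t = measure_pmf.expectation ?p (\<lambda>s. (b J t s)\<^sup>2)
      - (measure_pmf.expectation ?p (b J t))\<^sup>2" for J t
  have b: "b J t 0 = 0" "summable (\<lambda>s. \<bar>b J t s\<bar> * sqrt (pmf ?p s))"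
    if "finite J" "J \<subseteq> {1..}" for J t
  proof -
    show "b J t 0 = 0" unfolding b_def using a0 that by (intro sum.neutral) auto
    have "summable (\<lambda>s. \<Sum>w\<in>J. \<bar>t w\<bar> * (\<bar>?a w s\<bar> * sqrt (pmf ?p s)))"
      by (intro summable_sum summable_mult abs_sum) (use that in auto)
    then show "summable (\<lambda>s. \<bar>b J t s\<bar> * sqrt (pmf ?p s))"
    proof (rule summable_comparison_test')
      fix s
      have "\<bar>b J t s\<bar> \<le> (\<Sum>w\<in>J. \<bar>t w\<bar> * \<bar>?a w s\<bar>)"
        unfolding b_def by (rule order_trans[OF sum_abs]) (simp add: abs_mult)
      then have "\<bar>b J t s\<bar> * sqrt (pmf ?p s) \<le> (\<Sum>w\<in>J. \<bar>t w\<bar> * \<bar>?a w s\<bar>) * sqrt (pmf ?p s)"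
        by (rule mult_right_mono) simp
      then show "norm (\<bar>b J t s\<bar> * sqrt (pmf ?p s)) \<le> (\<Sum>w\<in>J. \<bar>t w\<bar> * (\<bar>?a w s\<bar> * sqrt (pmf ?p s)))"
        by (simp add: sum_distrib_right mult.assoc)
    qed
  qed
  have b_moments: "integrable ?p (b J t)" "integrable ?p (\<lambda>s. (b J t s)\<^sup>2)"
    "measure_pmf.expectation ?p (b J t) = (\<Sum>s. b J t s * pmf ?p s)"
    "measure_pmf.expectation ?p (\<lambda>s. (b J t s)\<^sup>2) = (\<Sum>s. (b J t s)\<^sup>2 * pmf ?p s)"
    if "finite J" "J \<subseteq> {1..}" for J t
    using pmf_expectation_suminf[of "b J t", OF summable_abs_pmf_if_summable_sqrt[OF b(2)[OF that, of t]]]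
      pmf_expectation_suminf[of "\<lambda>s. (b J t s)\<^sup>2" ?p]
      summable_square_pmf_if_summable_sqrt[OF b(2)[OF that, of t]] by auto
  have a_eq_b: "?a w = b {w} (\<lambda>_. 1)" for w
    by (simp add: b_def[abs_def])
  have mean: "measure_pmf.expectation ?p (b J t) = (\<Sum>w\<in>J. t w * pmf W w)"
    if "finite J" "J \<subseteq> {1..}" for J t
  proof -
    have "integrable ?p (?a w)" if "w \<ge> 1" for w
      unfolding a_eq_b using that by (intro b_moments(1)) auto
    then show ?thesis unfolding b_def[abs_def]
      using that by (subst Bochner_Integration.integral_sum)
        (auto intro!: sum.cong simp: thinned_pmf_expectation_S_coeff[OF q] subset_eq)
  qed
  have comb_law: "distr M' borel (\<lambda>\<omega>. \<Sum>w\<in>J. t w * ?Y w \<omega>) = normal_law 0 (sqrt (V J t))"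
    and V_nonneg: "V J t \<ge> 0"
    and comb_meas: "(\<lambda>\<omega>. \<Sum>w\<in>J. t w * ?Y w \<omega>) \<in> borel_measurable M'"
    if J: "finite J" "J \<subseteq> {1..}" for J t
  proof -
    show meas: "(\<lambda>\<omega>. \<Sum>w\<in>J. t w * ?Y w \<omega>) \<in> borel_measurable M'"
      by (intro borel_measurable_sum borel_measurable_times Y_meas borel_measurable_const) (use J in auto)
    have "AE \<omega> in M'. \<forall>w\<in>J. (\<lambda>s. ?a w s * \<xi> s \<omega>) sums ?Y w \<omega>"
      by (rule AE_finite_allI[OF J(1)]) (use J Y_sums in auto)
    then have sums: "AE \<omega> in M'. (\<lambda>s. b J t s * \<xi> s \<omega>) sums (\<Sum>w\<in>J. t w * ?Y w \<omega>)"
    proof eventually_elim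
      case (elim \<omega>)
      then have "(\<lambda>s. \<Sum>w\<in>J. t w * (?a w s * \<xi> s \<omega>)) sums (\<Sum>w\<in>J. t w * ?Y w \<omega>)"
        by (intro sums_sum sums_mult) auto
      then show ?case by (simp add: b_def sum_distrib_right mult.assoc)
    qed
    show "distr M' borel (\<lambda>\<omega>. \<Sum>w\<in>J. t w * ?Y w \<omega>) = normal_law 0 (sqrt (V J t))" "V J t \<ge> 0"
      using \<xi>.series_law[of "b J t", OF b[OF J] meas sums] by (simp_all add: V_def b_moments[OF J])
  qed

  have summ: "\<forall>w\<ge>1. AE \<omega> in M'. summable (S_term q (\<lambda>s. \<xi> s \<omega>) w)"
  proof (intro allI impI)
    fix w :: nat assume "w \<ge> 1"
    from Y_sums[OF this] show "AE \<omega> in M'. summable (S_term q (\<lambda>s. \<xi> s \<omega>) w)"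
      by eventually_elim (simp add: summable_S_term_iff sums_summable)
  qed

  have fdd: "fdd_convergence {1..} M (\<lambda>N w \<omega>. sqrt (real N) * (est_pmf q X N \<omega> w - pmf W w)) M' ?Y"
  proof (rule fdd_convergenceI[OF M M'])
    show "(\<lambda>\<omega>. sqrt (real N) * (est_pmf q X N \<omega> w - pmf W w)) \<in> borel_measurable M" for N w
      unfolding est_pmf_eq
      by (intro borel_measurable_times borel_measurable_diff borel_measurable_const borel_measurable_sum
            measurable_compose[OF X_meas]) auto
    show "?Y w \<in> borel_measurable M'" if "w \<in> {1..}" for w using Y_meas that by simp
    fix J :: "nat set" and t :: "nat \<Rightarrow> real" and f :: "real \<Rightarrow> real"
    assume J: "finite J" "J \<subseteq> {1..}" and f: "\<And>x. isCont f x" "\<And>x. \<bar>f x\<bar> \<le> 1"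
    have comb: "(\<Sum>j\<in>J. t j * (sqrt (real N) * (est_pmf q X N \<omega> j - pmf W j)))
        = sqrt (real N) * ((1 / real N) * (\<Sum>k = 1..N. b J t (X k \<omega>))
            - measure_pmf.expectation ?p (b J t))" for N \<omega>
    proof -
      have "(\<Sum>k = 1..N. b J t (X k \<omega>)) = (\<Sum>j\<in>J. t j * (\<Sum>k = 1..N. ?a j (X k \<omega>)))"
        unfolding b_def by (subst sum.swap) (simp add: sum_distrib_left)
      then show ?thesis
        by (simp add: est_pmf_eq mean[OF J] sum_distrib_left sum_subtractf right_diff_distrib
              sum_divide_distrib mult_ac)
    qed
    \<comment> \<open>Both limits are written as an integral against the same normal law.\<close>
    have "(\<integral>\<omega>. f (\<Sum>j\<in>J. t j * ?Y j \<omega>) \<partial>M') = integral\<^sup>L (normal_law 0 (sqrt (V J t))) f"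
      unfolding comb_law[OF J, symmetric]
      by (subst integral_distr)
         (use comb_meas[OF J] f in \<open>auto intro!: borel_measurable_continuous_onI continuous_at_imp_continuous_on\<close>)
    then show "(\<lambda>N. \<integral>\<omega>. f (\<Sum>j\<in>J. t j * (sqrt (real N) * (est_pmf q X N \<omega> j - pmf W j))) \<partial>M)
        \<longlonglongrightarrow> (\<integral>\<omega>. f (\<Sum>j\<in>J. t j * ?Y j \<omega>) \<partial>M')"
      unfolding comb using clt_pmf_sample[OF M X_indep X_law b_moments(2)[OF J] f]
      by (simp add: V_def)
  qed

  have gauss: "gaussian_process M' {1..} ?Y"
    unfolding gaussian_process_def gaussian_rv_iff_normal_law
  proof (intro allI impI)
    fix J :: "nat set" and c :: "nat \<Rightarrow> real"
    assume "finite J \<and> J \<subseteq> {1..}"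
    then have J: "finite J" "J \<subseteq> {1..}" by auto
    show "(\<lambda>\<omega>. \<Sum>i\<in>J. c i * ?Y i \<omega>) \<in> borel_measurable M' \<and>
      (\<exists>\<mu> \<sigma>. \<sigma> \<ge> 0 \<and> distr M' borel (\<lambda>\<omega>. \<Sum>i\<in>J. c i * ?Y i \<omega>) = normal_law \<mu> \<sigma>)"
      by (intro conjI exI[of _ 0] exI[of _ "sqrt (V J c)"] comb_meas[OF J] comb_law[OF J]
            real_sqrt_ge_zero V_nonneg[OF J])
  qed

  \<comment> \<open>The case of a singleton \<open>J\<close> with coefficient 1: the second moment
    of \<open>?a w\<close> is \<open>R_coeff\<close> and its mean is \<open>pmf W w\<close>.\<close>
  have mom: "(\<integral>\<omega>. ?Y w \<omega> \<partial>M') = 0"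
      "(\<integral>\<omega>. (?Y w \<omega>)\<^sup>2 \<partial>M') = enn2real (R_coeff q W w) - (pmf W w)\<^sup>2" if w: "w \<ge> 1" for w
  proof -
    have J: "finite {w}" "{w} \<subseteq> {1..}" using w by auto
    have law: "distr M' borel (?Y w) = normal_law 0 (sqrt (V {w} (\<lambda>_. 1)))"
      using comb_law[OF J, of "\<lambda>_. 1"] by simp
    have "V {w} (\<lambda>_. 1) = enn2real (R_coeff q W w) - (pmf W w)\<^sup>2"
      unfolding V_def R_coeff_eq[OF q R_fin[OF w]] b_moments(4)[OF J] mean[OF J]
      by (simp add: a_eq_b)
    then show "(\<integral>\<omega>. ?Y w \<omega> \<partial>M') = 0"
      "(\<integral>\<omega>. (?Y w \<omega>)\<^sup>2 \<partial>M') = enn2real (R_coeff q W w) - (pmf W w)\<^sup>2"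
      using normal_law_moments(3,4)[OF Y_meas[OF w] law] V_nonneg[OF J, of "\<lambda>_. 1"] by simp_all
  qed
  show ?thesis using summ fdd gauss mom by blast
qed

end
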